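(* Let $R(\lambda)\in\mathbb{F}(\lambda)^{p\times m}$ be a singular rational matrix expressed in the form $R(\lambda)=D(\lambda)+C(\lambda)A(\lambda)^{-1}B(\lambda)$, for some nonsingular polynomial matrix $A(\lambda)\in\mathbb{F}[\lambda]^{n\times n}$ and polynomial matrices $B(\lambda)\in\mathbb{F}[\lambda]^{n\times m}$, $C(\lambda)\in\mathbb{F}[\lambda]^{p\times n}$ and $D(\lambda)\in\mathbb{F}[\lambda]^{p\times m}$. Let $L_A(\lambda)=\begin{bmatrix}M_A(\lambda)\\ K_A(\lambda)\end{bmatrix}$ and $L_D(\lambda)=\begin{bmatrix}M_D(\lambda)\\ K_D(\lambda)\end{bmatrix}$ be strong block minimal basis pencils associated with $A(\lambda)$ and $D(\lambda)$, respectively; let $N_A(\lambda)$ and $N_D(\lambda)$ be minimal bases dual to $K_A(\lambda)$ and $K_D(\lambda)$, respectively, each with all its row degrees equal, with $M_A(\lambda)N_A(\lambda)^T=A(\lambda)$ and $M_D(\lambda)N_D(\lambda)^T=D(\lambda)$, and let $\rho_A:=\deg N_A(\lambda)$, $\rho_D:=\deg N_D(\lambda)$. Let $M_C(\lambda)$ and $M_B(\lambda)$ be linear polynomial matrices such that $M_C(\lambda)N_A(\lambda)^T=C(\lambda)$ and $M_B(\lambda)N_D(\lambda)^T=B(\lambda)$. Consider the linear polynomial system matrix $$\mathcal{L}(\lambda)=\left[\begin{array}{c|c} M_A(\lambda) & M_B(\lambda)\\ K_A(\lambda) & 0\\ \hline -M_C(\lambda) & M_D(\lambda)\\ 0 &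 K_D(\lambda)\end{array}\right]\in\mathbb{F}[\lambda]^{(n+p+\rho_An+\rho_Dm)\times(n+m+\rho_An+\rho_Dm)},$$ with state matrix $L_A(\lambda)$, and let $\widehat R(\lambda)$ be its transfer function matrix. If $$\operatorname{rank}\begin{bmatrix}A(\lambda_0)\\ C(\lambda_0)\end{bmatrix}=n\ \text{ for all }\lambda_0\in\mathbb{F},\quad\text{and}\quad\operatorname{rank}\begin{bmatrix}\operatorname{rev}_{\rho_A+1}A(0)\\ \operatorname{rev}_{\rho_A+1}C(0)\end{bmatrix}=n,$$ then the following statements hold: (a) If $\left\{\begin{bmatrix}y_i(\lambda)\\ x_i(\lambda)\end{bmatrix}\right\}_{i=1}^{s}$ is a right minimal basis of $\mathcal{L}(\lambda)$, where $x_i(\lambda)\in\mathbb{F}[\lambda]^{(\rho_D+1)m}$, then $\{x_i(\lambda)\}_{i=1}^s$ is a right minimal basis of $\widehat R(\lambda)$, and there exists a right minimal basis $\{u_i(\lambda)\}_{i=1}^s$ of $R(\lambda)$ such that $x_i(\lambda)=N_D(\lambda)^Tu_i(\lambda)$, for $i=1,\ldots,s$. (b) If $\epsilon_1\le\cdots\le\epsilon_s$ are the right minimal indices of $\mathcal{L}(\lambda)$, then $\epsilon_1\le\cdots\le\epsilon_s$ are the right minimal indices of $\widehat R(\lambda)$, and $\epsilon_1-\rho_D\le\cdots\le\epsilon_s-\rho_D$ are the right minimal indices of $R(\lambda)$.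
   Context: $\mathbb{F}$ is an algebraically closed field (not including infinity); $\mathbb{F}[\lambda]$ and $\mathbb{F}(\lambda)$ are the polynomials and rational functions over $\mathbb{F}$. A rational matrix is regular if it is square with determinant not identically zero, and singular otherwise. A polynomial matrix is linear if all its entries have degree at most $1$. For an integer $g$ and a rational matrix $G(\lambda)$, $\operatorname{rev}_gG(\lambda):=\lambda^gG(1/\lambda)$, and $\operatorname{rev}_gG(0)$ means $\operatorname{rev}_gG(\lambda)$ evaluated at $\lambda=0$. Minimal bases and indices: a minimal basis of a subspace $\mathcal{V}$ of $\mathbb{F}(\lambda)^{N}$ is a basis of $\mathcal{V}$ consisting of polynomial vectors whose sum of degrees is minimal among all polynomial bases of $\mathcal{V}$; the ordered list of degrees of its vectors depends only on $\mathcal{V}$, and these degrees are the minimal indices of $\mathcal{V}$. The right minimal bases and right minimal indices of a rational matrix $G(\lambda)$ are those of its right nullspace $\mathcal{N}_r(G)=\{x(\lambda)\in\mathbb{F}(\lambda)^{N\times 1}:G(\lambda)x(\lambda)=0\}$, where $N$ is the number of columns of $G$. A polynomial matrix with fewer rows than columns is called a minimal basis if its rows form a minimal basis of the subspace they span. Minimal bases $K(\lambda)\in\mathbb{F}[\lambda]^{k\times l}$ and $N(\lambda)\in\mathbb{F}[\lambda]^{q\times l}$ are dual if $k+q=l$ and $K(\lambda)N(\lambda)^T=0$. The $i$th row degree of a polynomial matrix is the degree of its $i$th row. Strong block minimal basis pencil (degenerate form, the only one used here): a linear polynomial matrix $\begin{bmatrix}M(\lambda)\\ K(\lambda)\end{bmatrix}$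 where $K(\lambda)$ is a minimal basis with all its row degrees equal to $1$ and the row degrees of a minimal basis $N(\lambda)$ dual to $K(\lambda)$ are all equal. It is associated with a polynomial matrix $P(\lambda)$ if $M(\lambda)N(\lambda)^T=P(\lambda)$. If $P(\lambda)$ has $c$ columns and $\rho=\deg N(\lambda)$, then $K(\lambda)$ has size $\rho c\times(\rho+1)c$. For polynomial matrices $\mathsf{A}$ (square and regular), $\mathsf{B},\mathsf{C},\mathsf{D}$ of compatible sizes, $\begin{bmatrix}\mathsf{A}(\lambda)&\mathsf{B}(\lambda)\\ -\mathsf{C}(\lambda)&\mathsf{D}(\lambda)\end{bmatrix}$ is a polynomial system matrix with state matrix $\mathsf{A}(\lambda)$ and transfer function matrix $\mathsf{D}(\lambda)+\mathsf{C}(\lambda)\mathsf{A}(\lambda)^{-1}\mathsf{B}(\lambda)$. For $\mathcal{L}(\lambda)$ in the claim, $\widehat R(\lambda)=\begin{bmatrix}M_D(\lambda)\\ K_D(\lambda)\end{bmatrix}+\begin{bmatrix}M_C(\lambda)\\ 0\end{bmatrix}L_A(\lambda)^{-1}\begin{bmatrix}M_B(\lambda)\\ 0\end{bmatrix}$. *)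

theory Defs
  imports
    "Jordan_Normal_Form.DL_Rank"
    "Jordan_Normal_Form.Matrix_Kernel"
    "Jordan_Normal_Form.Gauss_Jordan_Elimination"
    "HOL-Computational_Algebra.Polynomial_Factorial"
begin

text \<open>
  A polynomial matrix over the field \<open>'a\<close> is an \<open>'a poly mat\<close>, a rational matrix is an
  \<open>'a poly fract mat\<close>. Matrices and vectors carry their own (natural number) dimensions.
\<close>

abbreviation rat_mat :: "'a::field poly mat \<Rightarrow> 'a poly fract mat" where
  "rat_mat \<equiv> map_mat to_fract"

abbreviation rat_vec :: "'a::field poly vec \<Rightarrow> 'a poly fract vec" where
  "rat_vec \<equiv> map_vec to_fract"

definition regular_mat :: "'b::comm_ring_1 mat \<Rightarrow> bool" where
  "regular_mat G \<longleftrightarrow> square_mat G \<and> det G \<noteq> 0"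

definition singular_mat :: "'b::comm_ring_1 mat \<Rightarrow> bool" where
  "singular_mat G \<longleftrightarrow> \<not> regular_mat G"

definition linear_mat :: "'a::zero poly mat \<Rightarrow> bool" where
  "linear_mat P \<longleftrightarrow> (\<forall>i<dim_row P. \<forall>j<dim_col P. degree (P $$ (i, j)) \<le> 1)"

definition eval_mat :: "'a::comm_semiring_0 poly mat \<Rightarrow> 'a \<Rightarrow> 'a mat" where
  "eval_mat P x = map_mat (\<lambda>q. poly q x) P"


subsection \<open>Evaluation of rational functions and reversals\<close>

text \<open>
  The value at \<open>x\<close> of a rational function \<open>a/b\<close>, where \<open>x\<close> lies in a field \<open>'b\<close> into which the
  coefficient field is mapped by the field embedding \<open>h\<close>. Any representation whose denominator
  does not vanish at \<open>x\<close> may be used; at a pole the value is unspecified.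
\<close>
definition ratfun_at :: "('a::field \<Rightarrow> 'b::field) \<Rightarrow> 'a poly fract \<Rightarrow> 'b \<Rightarrow> 'b" where
  "ratfun_at h r x = (THE v. \<exists>a b. r = Fraction_Field.Fract a b \<and>
     poly (map_poly h b) x \<noteq> 0 \<and> v = poly (map_poly h a) x / poly (map_poly h b) x)"

abbreviation ratfun_const :: "'a::field \<Rightarrow> 'a poly fract" where
  "ratfun_const c \<equiv> to_fract [:c:]"

abbreviation ratfun_var :: "'a::field poly fract" where
  "ratfun_var \<equiv> to_fract [:0, 1:]"

definition rev_mat :: "int \<Rightarrow> 'a::field poly fract mat \<Rightarrow> 'a poly fract mat" where
  "rev_mat g G = map_mat (\<lambda>r. ratfun_var powi g * ratfun_at ratfun_const r (1 / ratfun_var)) G"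

definition eval_rat_mat :: "'a::field poly fract mat \<Rightarrow> 'a \<Rightarrow> 'a mat" where
  "eval_rat_mat G x = map_mat (\<lambda>r. ratfun_at id r x) G"


subsection \<open>Minimal bases and minimal indices\<close>

text \<open>The \<open>insert 0\<close> only serves vectors and matrices without entries.\<close>

definition vec_degree :: "'a::zero poly vec \<Rightarrow> nat" where
  "vec_degree v = Max (insert 0 {degree (v $ i) | i. i < dim_vec v})"

definition mat_degree :: "'a::zero poly mat \<Rightarrow> nat" where
  "mat_degree P = Max (insert 0 {degree (P $$ (i, j)) | i j. i < dim_row P \<and> j < dim_col P})"

abbreviation row_degree :: "'a::zero poly mat \<Rightarrow> nat \<Rightarrow> nat" where
  "row_degree P i \<equiv> vec_degree (row P i)"

text \<open>
  Bases are ordered families, i.e. lists without repetition. In the following, \<open>V\<close> is meant to be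
  a subspace of the space of rational vectors with \<open>N\<close> entries.
\<close>

definition poly_basis :: "nat \<Rightarrow> 'a::field poly fract vec set \<Rightarrow> 'a poly vec list \<Rightarrow> bool" where
  "poly_basis N V xs \<longleftrightarrow> set xs \<subseteq> carrier_vec N \<and> distinct xs \<and>
     vectorspace.basis class_ring (module_vec TYPE('a poly fract) N\<lparr>carrier := V\<rparr>)
       (rat_vec ` set xs)"

definition minimal_basis :: "nat \<Rightarrow> 'a::field poly fract vec set \<Rightarrow> 'a poly vec list \<Rightarrow> bool" where
  "minimal_basis N V xs \<longleftrightarrow> poly_basis N V xs \<and>
     (\<forall>ys. poly_basis N V ys \<longrightarrow> (\<Sum>x\<leftarrow>xs. vec_degree x) \<le> (\<Sum>y\<leftarrow>ys. vec_degree y))"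

text \<open>
  Relational: \<open>minimal_indices N V es\<close> means that \<open>es\<close> is the ordered list of minimal indices of
  \<open>V\<close>. All minimal bases of a subspace have the same ordered degrees, so at most one \<open>es\<close> qualifies.
\<close>
definition minimal_indices :: "nat \<Rightarrow> 'a::field poly fract vec set \<Rightarrow> nat list \<Rightarrow> bool" where
  "minimal_indices N V es \<longleftrightarrow> (\<exists>xs. minimal_basis N V xs \<and> es = sort (map vec_degree xs))"

definition right_minimal_basis :: "'a::field poly fract mat \<Rightarrow> 'a poly vec list \<Rightarrow> bool" where
  "right_minimal_basis G xs \<longleftrightarrow> minimal_basis (dim_col G) (mat_kernel G) xs"

definition right_minimal_indices :: "'a::field poly fract mat \<Rightarrow> nat list \<Rightarrow> bool" where
  "right_minimal_indices G es \<longleftrightarrow> minimal_indices (dim_col G) (mat_kernel G) es"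

definition minimal_basis_mat :: "'a::field poly mat \<Rightarrow> bool" where
  "minimal_basis_mat K \<longleftrightarrow> dim_row K < dim_col K \<and>
     minimal_basis (dim_col K) (vec_space.row_space (dim_col K) (rat_mat K)) (rows K)"

definition dual_minimal_bases :: "'a::field poly mat \<Rightarrow> 'a poly mat \<Rightarrow> bool" where
  "dual_minimal_bases K N \<longleftrightarrow> minimal_basis_mat K \<and> minimal_basis_mat N \<and>
     dim_col K = dim_col N \<and> dim_row K + dim_row N = dim_col K \<and>
     K * N\<^sup>T = 0\<^sub>m (dim_row K) (dim_row N)"

definition equal_row_degrees :: "'a::zero poly mat \<Rightarrow> bool" where
  "equal_row_degrees N \<longleftrightarrow>
     (\<forall>i<dim_row N. \<forall>j<dim_row N. row_degree N i = row_degree N j)"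


subsection \<open>Strong block minimal basis pencils and polynomial system matrices\<close>

text \<open>
  The pencil is \<open>M @\<^sub>r K\<close> (\<open>M\<close> stacked on top of \<open>K\<close>), given by its two blocks.
\<close>
definition strong_block_minimal_basis_pencil :: "'a::field poly mat \<Rightarrow> 'a poly mat \<Rightarrow> bool" where
  "strong_block_minimal_basis_pencil M K \<longleftrightarrow>
     dim_col M = dim_col K \<and> linear_mat (M @\<^sub>r K) \<and>
     minimal_basis_mat K \<and> (\<forall>i<dim_row K. row_degree K i = 1) \<and>
     (\<exists>N. dual_minimal_bases K N \<and> equal_row_degrees N)"

text \<open>
  The sign is on the lower left block: the system matrix of \<open>A\<close>, \<open>B\<close>, \<open>C\<close>, \<open>D\<close> has rows
  \<open>(A, B)\<close> and \<open>(-C, D)\<close>, and its transfer function matrix is \<open>D + C A\<^sup>-\<^sup>1 B\<close>. The latter is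
  meaningful if \<open>A\<close> is regular.
\<close>
definition system_matrix ::
  "'a::field poly mat \<Rightarrow> 'a poly mat \<Rightarrow> 'a poly mat \<Rightarrow> 'a poly mat \<Rightarrow> 'a poly mat" where
  "system_matrix A B C D = four_block_mat A B (- C) D"

definition transfer_function ::
  "'a::field poly mat \<Rightarrow> 'a poly mat \<Rightarrow> 'a poly mat \<Rightarrow> 'a poly mat \<Rightarrow> 'a poly fract mat" where
  "transfer_function A B C D =
     rat_mat D + rat_mat C * the (mat_inverse (rat_mat A)) * rat_mat B"

end

theory Submission
  imports Defs "Jordan_Normal_Form.Char_Poly"
begin

text \<open>
  Write \<open>v\<close> and \<open>u\<close> for rational vectors with \<open>n\<close> and \<open>m\<close> entries. Since \<open>K\<^sub>A\<close> and \<open>N\<^sub>A\<close>, and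
  likewise \<open>K\<^sub>D\<close> and \<open>N\<^sub>D\<close>, are dual, the rows \<open>(K\<^sub>A, 0)\<close> and \<open>(0, K\<^sub>D)\<close> of the pencil force every
  vector in its right nullspace to have the form \<open>(N\<^sub>A\<^sup>T v, N\<^sub>D\<^sup>T u)\<close>, and the other rows then say that
  \<open>(v, u)\<close> is in the right nullspace of the system matrix of \<open>A\<close>, \<open>B\<close>, \<open>C\<close>, \<open>D\<close>. As \<open>A\<close> is regular,
  this means \<open>R u = 0\<close> and \<open>v = - A\<^sup>-\<^sup>1 B u\<close>. So \<open>u \<mapsto> (N\<^sub>A\<^sup>T v, N\<^sub>D\<^sup>T u)\<close> maps the right nullspace of \<open>R\<close>
  isomorphically onto that of the pencil and, forgetting the first component, \<open>u \<mapsto> N\<^sub>D\<^sup>T u\<close> maps it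
  onto the right nullspace of the transfer function of the pencil.

  Both maps identify the polynomial vectors on the two sides and raise every degree by \<open>\<rho>\<^sub>D\<close>; as all
  bases of a nullspace have the same length, they then identify the minimal bases as well. This last
  step is the locale \<open>degree_shift\<close>, and the theorem consists of two instances of it.

  What makes polynomials and degrees behave is injectivity of constant matrices. If a polynomial
  matrix \<open>P\<close> is injective at every point of the field, then \<open>P u\<close> polynomial implies \<open>u\<close> polynomial,
  because a root of a denominator of \<open>u\<close> would give a kernel vector of \<open>P\<close> at that root
  (\<open>polynomial_of_polynomial_image\<close>). If the matrix of the coefficients of degree \<open>g\<close> is injective,
  where \<open>g\<close> bounds the degrees of the entries, then \<open>P u\<close> has degree exactly \<open>g + deg u\<close>
  (\<open>vec_degree_mult_eq\<close>). For \<open>N\<^sub>A\<^sup>T\<close> and \<open>N\<^sub>D\<^sup>T\<close> both properties follow from minimality: a dependence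
  between the values or the leading coefficients of the rows would allow replacing a row by one of
  smaller degree. For the matrix \<open>A\<close> on top of \<open>C\<close>, with \<open>g = \<rho>\<^sub>A + 1\<close>, they are the two rank
  hypotheses. The equations \<open>A v = - M\<^sub>B x\<close> and \<open>C v = M\<^sub>D x\<close> with \<open>x = N\<^sub>D\<^sup>T u\<close> then show that \<open>v\<close> is
  polynomial whenever \<open>u\<close> is, and that \<open>\<rho>\<^sub>A + 1 + deg v \<le> 1 + deg x\<close>. Hence \<open>N\<^sub>A\<^sup>T v\<close> never has larger
  degree than \<open>N\<^sub>D\<^sup>T u\<close>, and it is the latter that determines the degree of the pair.
\<close>

section \<open>Injective matrices over a field\<close>

definition injective_mat :: "'b::comm_ring_1 mat \<Rightarrow> bool" where
  "injective_mat P \<longleftrightarrow>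
     (\<forall>v\<in>carrier_vec (dim_col P). P *\<^sub>v v = 0\<^sub>v (dim_row P) \<longrightarrow> v = 0\<^sub>v (dim_col P))"

lemma injective_matI:
  assumes "P \<in> carrier_mat nr nc"
    and "\<And>v. v \<in> carrier_vec nc \<Longrightarrow> P *\<^sub>v v = 0\<^sub>v nr \<Longrightarrow> v = 0\<^sub>v nc"
  shows "injective_mat P"
  using assms unfolding injective_mat_def by auto

lemma injective_matD:
  assumes "injective_mat P" "P \<in> carrier_mat nr nc" "v \<in> carrier_vec nc" "P *\<^sub>v v = 0\<^sub>v nr"
  shows "v = 0\<^sub>v nc"
  using assms unfolding injective_mat_def by auto

lemma injective_mat_eqD:
  fixes P :: "'b::field mat"
  assumes "injective_mat P" "P \<in> carrier_mat nr nc" "v \<in> carrier_vec nc" "w \<in> carrier_vec nc"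
    and "P *\<^sub>v v = P *\<^sub>v w"
  shows "v = w"
proof -
  have "P *\<^sub>v (v - w) = P *\<^sub>v v - P *\<^sub>v w"
    using assms by (intro mult_minus_distrib_mat_vec)
  also have "\<dots> = 0\<^sub>v nr"
    using assms by auto
  finally have "v - w = 0\<^sub>v nc"
    using assms by (intro injective_matD[of P nr nc]) auto
  show ?thesis
  proof (rule eq_vecI)
    fix i assume i: "i < dim_vec w"
    have "(v - w) $ i = 0" using \<open>v - w = 0\<^sub>v nc\<close> i assms by simp
    then show "v $ i = w $ i" using i assms by simp
  qed (use assms in simp)
qed

lemma mult_unit_vec:
  fixes X :: "'b::field mat"
  assumes "X \<in> carrier_mat nr nc" "i < nc"
  shows "X *\<^sub>v unit_vec nc i = col X i"
  using assms by (intro eq_vecI) auto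

lemma mult_zero_vec:
  fixes X :: "'b::field mat"
  assumes "X \<in> carrier_mat nr nc"
  shows "X *\<^sub>v 0\<^sub>v nc = 0\<^sub>v nr"
  using assms by (intro eq_vecI) auto

lemma zero_mat_mult_vec:
  fixes v :: "'b::field vec"
  assumes "v \<in> carrier_vec nc"
  shows "0\<^sub>m nr nc *\<^sub>v v = 0\<^sub>v nr"
  using assms by (intro eq_vecI) auto

lemma uminus_mult_mat_vec:
  fixes P :: "'b::comm_ring_1 mat"
  assumes "P \<in> carrier_mat nr nc" "v \<in> carrier_vec nc"
  shows "- P *\<^sub>v v = - (P *\<^sub>v v)"
  using assms by (intro eq_vecI) auto

lemma mult_mat_uminus_vec:
  fixes P :: "'b::comm_ring_1 mat"
  assumes "P \<in> carrier_mat nr nc" "v \<in> carrier_vec nc"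
  shows "P *\<^sub>v - v = - (P *\<^sub>v v)"
  using assms by (intro eq_vecI) auto

lemma add_eq_zero_vec_iff:
  fixes a b :: "'b::ab_group_add vec"
  assumes "a \<in> carrier_vec n" "b \<in> carrier_vec n"
  shows "a + b = 0\<^sub>v n \<longleftrightarrow> a = - b"
proof -
  have "a + b = 0\<^sub>v n \<longleftrightarrow> (\<forall>i<n. a $ i + b $ i = 0)"
    using assms by (auto simp: vec_eq_iff)
  also have "\<dots> \<longleftrightarrow> (\<forall>i<n. a $ i = - b $ i)"
    by (simp add: add_eq_0_iff2)
  also have "\<dots> \<longleftrightarrow> a = - b"
    using assms by (auto simp: vec_eq_iff)
  finally show ?thesis .
qed

lemma append_rows_kernel:
  fixes P Q :: "'b::field mat"
  assumes P: "P \<in> carrier_mat r1 c" and Q: "Q \<in> carrier_mat r2 c" and v: "v \<in> carrier_vec c"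
  shows "(P @\<^sub>r Q) *\<^sub>v v = 0\<^sub>v (r1 + r2) \<longleftrightarrow> P *\<^sub>v v = 0\<^sub>v r1 \<and> Q *\<^sub>v v = 0\<^sub>v r2"
proof -
  have "0\<^sub>v (r1 + r2) = 0\<^sub>v r1 @\<^sub>v (0\<^sub>v r2 :: 'b vec)"
    by (intro eq_vecI) auto
  moreover have "P *\<^sub>v v \<in> carrier_vec r1"
    using P v by (rule mult_mat_vec_carrier)
  ultimately show ?thesis
    unfolding mat_mult_append[OF P Q v] by (simp add: append_vec_eq[of _ r1])
qed

context vec_space
begin

lemma injective_mat_iff_lin_indpt:
  fixes X :: "'a mat"
  assumes X: "X \<in> carrier_mat n nc"
  shows "injective_mat X \<longleftrightarrow> distinct (cols X) \<and> lin_indpt (set (cols X))"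
proof
  assume inj: "injective_mat X"
  have "distinct (cols X)"
  proof (rule ccontr)
    assume "\<not> distinct (cols X)"
    then obtain i j where ij: "i < nc" "j < nc" "i \<noteq> j" "col X i = col X j"
      using X by (auto simp: distinct_conv_nth)
    have "(unit_vec nc i :: 'a vec) = unit_vec nc j"
    proof (rule injective_mat_eqD[OF inj X])
      show "X *\<^sub>v unit_vec nc i = X *\<^sub>v unit_vec nc j"
        using X ij by (simp add: mult_unit_vec)
    qed auto
    then have "unit_vec nc i $ i = (unit_vec nc j $ i :: 'a)"
      by simp
    then show False using ij by simp
  qed
  moreover have "lin_indpt (set (cols X))"
    using lin_depE[OF X _ \<open>distinct (cols X)\<close>] injective_matD[OF inj X] by blast
  ultimately show "distinct (cols X) \<and> lin_indpt (set (cols X))" ..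
next
  assume "distinct (cols X) \<and> lin_indpt (set (cols X))"
  then show "injective_mat X"
    using lin_depI[OF X] X by (auto intro!: injective_matI[OF X])
qed

lemma full_rank_injective:
  assumes X: "X \<in> carrier_mat n nc" and r: "rank X = nc"
  shows "injective_mat X"
proof -
  obtain S where S: "maximal S (\<lambda>T. T \<subseteq> set (cols X) \<and> lin_indpt T)"
    using maximal_exists[of "(\<lambda>T. T \<subseteq> set (cols X) \<and> lin_indpt T)" "card (set (cols X))" "{}"]
    by (meson List.finite_set card_mono empty_iff empty_subsetI finite_lin_indpt2 rev_finite_subset)
  then have "card S \<le> card (set (cols X))"
    by (simp add: card_mono maximal_def)
  then have "length (cols X) \<le> card (set (cols X))"
    using rank_card_indpt[OF X S] r X by simp
  then have "distinct (cols X)"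
    using card_distinct card_length le_antisym by blast
  then show ?thesis
    using full_rank_lin_indpt[OF X r] injective_mat_iff_lin_indpt[OF X] by blast
qed

end

lemma injective_square_inverse:
  fixes X :: "'b::field mat"
  assumes X: "X \<in> carrier_mat l l" and inj: "injective_mat X"
  obtains Y where "Y \<in> carrier_mat l l" "X * Y = 1\<^sub>m l" "Y * X = 1\<^sub>m l"
proof -
  have "det X \<noteq> 0"
    using det_0_iff_vec_prod_zero_field[OF X] injective_matD[OF inj X] by blast
  from det_non_zero_imp_unit[OF X this, of "()"] that show thesis
    unfolding Units_def ring_mat_def by auto
qed

lemma mat_inverse_injective:
  fixes X :: "'b::field mat"
  assumes X: "X \<in> carrier_mat n n" and inj: "injective_mat X"
  shows "the (mat_inverse X) \<in> carrier_mat n n" "X * the (mat_inverse X) = 1\<^sub>m n"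
    "the (mat_inverse X) * X = 1\<^sub>m n"
proof -
  obtain Y where "Y \<in> carrier_mat n n" "X * Y = 1\<^sub>m n" "Y * X = 1\<^sub>m n"
    using injective_square_inverse[OF X inj] by blast
  then have "X \<in> Units (ring_mat TYPE('b) n ())"
    using X by (auto simp: Units_def ring_mat_def)
  then have "mat_inverse X \<noteq> None"
    using mat_inverse(1)[OF X, of "()"] by blast
  then show "the (mat_inverse X) \<in> carrier_mat n n" "X * the (mat_inverse X) = 1\<^sub>m n"
    "the (mat_inverse X) * X = 1\<^sub>m n"
    using mat_inverse(2)[OF X] by auto
qed

text \<open>
  The columns are extended to a basis of the whole space; the first rows of the inverse of the
  resulting square matrix form a left inverse.
\<close>
lemma injective_left_inverse:
  fixes X :: "'b::field mat"
  assumes X: "X \<in> carrier_mat l r" and inj: "injective_mat X"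
  obtains Y where "Y \<in> carrier_mat r l" "Y * X = 1\<^sub>m r"
proof -
  interpret vec_space "TYPE('b)" l .
  have dist: "distinct (cols X)" and indpt: "lin_indpt (set (cols X))"
    using inj injective_mat_iff_lin_indpt[OF X] by auto
  have colsX: "set (cols X) \<subseteq> carrier_vec l"
    using X cols_dim by blast
  obtain C where C: "finite C" "C \<subseteq> carrier_vec l" "C \<inter> set (cols X) = {}"
      "int (card C) \<le> int (card (set (unit_vecs l :: 'b vec list))) - int (card (set (cols X)))"
      "span (set (cols X) \<union> C) = span (set (unit_vecs l))"
    using replacement[OF _ _ unit_vecs_carrier indpt] colsX span_unit_vecs_is_carrier by auto
  have cardX: "card (set (cols X)) = r"
    using dist X by (simp add: distinct_card)
  have cardU: "card (set (unit_vecs l :: 'b vec list)) = l"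
    using distinct_card[OF unit_vecs_distinct] by simp
  \<comment> \<open>A generating set with at most \<open>l\<close> elements is a basis, so it has exactly \<open>l\<close> elements.\<close>
  have card_le: "card (set (cols X) \<union> C) \<le> dim"
    using C(3,4) card_Un_le[of "set (cols X)" C] unfolding cardX cardU dim_is_n by linarith
  have bas: "basis (set (cols X) \<union> C)"
    using C colsX span_unit_vecs_is_carrier card_le
    by (intro dim_gen_is_basis) auto
  then have "card (set (cols X) \<union> C) = l"
    using dim_basis[OF _ bas] C(1) dim_is_n by simp
  then have cardC: "card C = l - r" "r \<le> l"
    using card_Un_disjoint[OF _ C(1), of "set (cols X)"] C(3) cardX by (auto simp: Int_commute)
  obtain cs where cs: "set cs = C" "distinct cs"
    using finite_distinct_list[OF C(1)] by blast
  have lencs: "length cs = l - r"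
    using cs cardC by (metis distinct_card)
  define Z where "Z = mat_of_cols l (cols X @ cs)"
  have Z: "Z \<in> carrier_mat l l"
    unfolding Z_def using X lencs cardC by auto
  have colsZ: "cols Z = cols X @ cs"
    unfolding Z_def using X C(2) cs colsX by (intro cols_mat_of_cols) auto
  have "injective_mat Z"
    unfolding injective_mat_iff_lin_indpt[OF Z] colsZ
    using dist cs C(3) bas unfolding basis_def by auto
  then obtain W where W: "W \<in> carrier_mat l l" "W * Z = 1\<^sub>m l"
    using injective_square_inverse[OF Z] by blast
  define Y where "Y = mat r l (\<lambda>(i, j). W $$ (i, j))"
  have "Y * X = 1\<^sub>m r"
  proof (rule eq_matI)
    fix i j assume ij: "i < dim_row (1\<^sub>m r :: 'b mat)" "j < dim_col (1\<^sub>m r :: 'b mat)"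
    have "row Y i = row W i"
      using ij W cardC by (intro eq_vecI) (auto simp: Y_def)
    moreover have "col X j = col Z j"
    proof -
      have "col Z j = cols Z ! j"
        using ij Z cardC by (subst cols_nth) auto
      also have "\<dots> = col X j"
        unfolding colsZ using ij X by (simp add: nth_append)
      finally show ?thesis ..
    qed
    ultimately have "(Y * X) $$ (i, j) = (W * Z) $$ (i, j)"
      using ij W(1) Z X cardC by (simp add: Y_def)
    then show "(Y * X) $$ (i, j) = 1\<^sub>m r $$ (i, j)"
      using ij cardC unfolding W(2) by simp
  qed (use X in \<open>auto simp: Y_def\<close>)
  then show thesis
    using that[of Y] by (simp add: Y_def)
qed

text \<open>
  A dimension count without dimensions: a right inverse \<open>J\<close> of \<open>K\<close> next to \<open>T\<close> gives a square
  injective matrix, so \<open>y = J a + T b\<close>, and multiplying by \<open>K\<close> shows \<open>a = 0\<close>.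
\<close>
lemma kernel_eq_range_of_complement:
  fixes K T :: "'b::field mat"
  assumes K: "K \<in> carrier_mat r l" and injK: "injective_mat K\<^sup>T"
    and T: "T \<in> carrier_mat l q" and injT: "injective_mat T"
    and l: "r + q = l" and KT: "K * T = 0\<^sub>m r q"
    and y: "y \<in> carrier_vec l" "K *\<^sub>v y = 0\<^sub>v r"
  obtains v where "v \<in> carrier_vec q" "y = T *\<^sub>v v"
proof -
  have Kt: "K\<^sup>T \<in> carrier_mat l r"
    using K by auto
  from injective_left_inverse[OF Kt injK]
  obtain Y where Y: "Y \<in> carrier_mat r l" "Y * K\<^sup>T = 1\<^sub>m r" .
  define J where "J = Y\<^sup>T"
  have J: "J \<in> carrier_mat l r"
    using Y by (simp add: J_def)
  have KJ: "K * J = 1\<^sub>m r"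
    using arg_cong[OF Y(2), of transpose_mat] transpose_mult[OF Y(1) Kt] by (simp add: J_def)
  \<comment> \<open>\<open>J\<close> and \<open>T\<close> side by side; the lower blocks have no rows.\<close>
  define Z where "Z = four_block_mat J T (0\<^sub>m 0 r) (0\<^sub>m 0 q)"
  have Z: "Z \<in> carrier_mat l l"
    using four_block_carrier_mat[OF J, of "0\<^sub>m 0 q" 0 q T] l by (simp add: Z_def)
  have Zv: "Z *\<^sub>v (a @\<^sub>v b) = J *\<^sub>v a + T *\<^sub>v b"
    if "a \<in> carrier_vec r" "b \<in> carrier_vec q" for a b
  proof -
    have "Z *\<^sub>v (a @\<^sub>v b) = (J *\<^sub>v a + T *\<^sub>v b) @\<^sub>v (0\<^sub>m 0 r *\<^sub>v a + 0\<^sub>m 0 q *\<^sub>v b)"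
      unfolding Z_def by (rule four_block_mat_mult_vec[OF J T]) (use that in auto)
    also have "\<dots> = J *\<^sub>v a + T *\<^sub>v b"
      by (rule eq_vecI) auto
    finally show ?thesis .
  qed
  have KZ: "K *\<^sub>v (Z *\<^sub>v (a @\<^sub>v b)) = a"
    if ab: "a \<in> carrier_vec r" "b \<in> carrier_vec q" for a b
  proof -
    have "K *\<^sub>v (Z *\<^sub>v (a @\<^sub>v b)) = K *\<^sub>v (J *\<^sub>v a) + K *\<^sub>v (T *\<^sub>v b)"
      unfolding Zv[OF ab] using K J T ab by (intro mult_add_distrib_mat_vec) auto
    also have "K *\<^sub>v (J *\<^sub>v a) = a"
      using assoc_mult_mat_vec[OF K J ab(1)] KJ ab by simp
    also have "K *\<^sub>v (T *\<^sub>v b) = 0\<^sub>v r"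
      using assoc_mult_mat_vec[OF K T ab(2)] ab(2) unfolding KT by (simp add: zero_mat_mult_vec)
    finally show ?thesis using ab by simp
  qed
  have split: "\<exists>a\<in>carrier_vec r. \<exists>b\<in>carrier_vec q. w = a @\<^sub>v b"
    if "w \<in> carrier_vec l" for w :: "'b vec"
    using that vec_first_last_append[of w r q] l
    by (metis vec_first_carrier vec_last_carrier)
  have "injective_mat Z"
  proof (rule injective_matI[OF Z])
    fix w :: "'b vec" assume w: "w \<in> carrier_vec l" "Z *\<^sub>v w = 0\<^sub>v l"
    obtain a b where ab: "a \<in> carrier_vec r" "b \<in> carrier_vec q" "w = a @\<^sub>v b"
      using split[OF w(1)] by blast
    have a: "a = 0\<^sub>v r"
      using KZ[OF ab(1,2)] w(2) K unfolding ab(3) by auto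
    have "T *\<^sub>v b = 0\<^sub>v l"
      using Zv[OF ab(1,2)] w(2) T ab(2) mult_zero_vec[OF J] unfolding ab(3) a by simp
    then have "b = 0\<^sub>v q"
      using injective_matD[OF injT T ab(2)] by simp
    then show "w = 0\<^sub>v l"
      unfolding ab(3) a using l by (intro eq_vecI) auto
  qed
  then obtain W where W: "W \<in> carrier_mat l l" "Z * W = 1\<^sub>m l"
    using injective_square_inverse[OF Z] by blast
  have "W *\<^sub>v y \<in> carrier_vec l"
    using W y by auto
  then obtain a b where ab: "a \<in> carrier_vec r" "b \<in> carrier_vec q" "W *\<^sub>v y = a @\<^sub>v b"
    using split by blast
  have "Z *\<^sub>v (a @\<^sub>v b) = y"
    unfolding ab(3)[symmetric] using assoc_mult_mat_vec[OF Z W(1) y(1)] W(2) y(1) by simp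
  moreover from this have "a = 0\<^sub>v r"
    using KZ[OF ab(1,2)] y(2) by simp
  ultimately have "y = T *\<^sub>v b"
    using Zv[OF ab(1,2)] ab T mult_zero_vec[OF J] by simp
  then show thesis using that ab by blast
qed

section \<open>Bases of polynomial vectors\<close>

interpretation to_fract_hom: inj_comm_ring_hom "to_fract :: 'a::idom \<Rightarrow> 'a fract"
  by unfold_locales auto

lemma rat_vec_append: "rat_vec (v @\<^sub>v w) = rat_vec v @\<^sub>v rat_vec w"
  by (intro eq_vecI) auto

lemma rat_mat_append_rows:
  assumes "P \<in> carrier_mat r1 c" "Q \<in> carrier_mat r2 c"
  shows "rat_mat (P @\<^sub>r Q) = rat_mat P @\<^sub>r rat_mat Q"
  using assms by (intro eq_matI) (auto simp: append_rows_def)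

lemma rat_mat_mult_assoc:
  fixes P Q :: "'a::field poly mat"
  assumes P: "P \<in> carrier_mat r k" and Q: "Q \<in> carrier_mat k c" and v: "v \<in> carrier_vec c"
  shows "rat_mat P *\<^sub>v (rat_mat Q *\<^sub>v v) = rat_mat (P * Q) *\<^sub>v v"
  using assoc_mult_mat_vec[of "rat_mat P" r k "rat_mat Q" c v] to_fract_hom.mat_hom_mult[OF P Q] assms
  by simp

abbreviation rat_cols :: "nat \<Rightarrow> 'a::field poly vec list \<Rightarrow> 'a poly fract mat" where
  "rat_cols N xs \<equiv> mat_of_cols N (map rat_vec xs)"

lemma rat_cols_carrier [simp]: "rat_cols N xs \<in> carrier_mat N (length xs)"
  using mat_of_cols_carrier(1)[of N "map rat_vec xs"] by simp

lemma col_rat_cols [simp]: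
  "i < length xs \<Longrightarrow> xs ! i \<in> carrier_vec N \<Longrightarrow> col (rat_cols N xs) i = rat_vec (xs ! i)"
  by (subst col_mat_of_cols) auto

definition vec_subspace :: "nat \<Rightarrow> 'b::field vec set \<Rightarrow> bool" where
  "vec_subspace N U \<longleftrightarrow> submodule class_ring U (module_vec TYPE('b) N)"

lemma vec_subspace_mat_kernel:
  fixes G :: "'b::field mat"
  assumes "G \<in> carrier_mat r N"
  shows "vec_subspace N (mat_kernel G)"
proof -
  interpret vec_space "TYPE('b)" N .
  show ?thesis
    unfolding vec_subspace_def
    by unfold_locales
      (insert assms mult_add_distrib_mat_vec[OF assms] mult_mat_vec[OF assms] mat_kernel[OF assms]
        mult_zero_vec[OF assms], auto)
qed

lemma vec_subspace_row_space:
  fixes G :: "'b::field mat"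
  assumes "G \<in> carrier_mat r N"
  shows "vec_subspace N (vec_space.row_space N G)"
proof -
  interpret vec_space "TYPE('b)" N .
  show ?thesis
    unfolding vec_subspace_def row_space_def
    using assms by (intro span_is_submodule) (auto simp: rows_def)
qed

text \<open>
  Turns the module-theoretic notion of a basis into two statements about the matrix whose columns
  are the basis vectors. All later arguments about bases are computations with that matrix.
\<close>
lemma poly_basis_iff:
  fixes U :: "'a::field poly fract vec set"
  assumes sub: "vec_subspace N U"
  shows "poly_basis N U xs \<longleftrightarrow>
    set xs \<subseteq> carrier_vec N \<and> injective_mat (rat_cols N xs) \<and>
    (\<lambda>c. rat_cols N xs *\<^sub>v c) ` carrier_vec (length xs) = U"
proof (cases "set xs \<subseteq> carrier_vec N")
  case False
  then show ?thesis by (auto simp: poly_basis_def)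
next
  case True
  interpret vec_space "TYPE('a poly fract)" N .
  let ?X = "rat_cols N xs" and ?S = "rat_vec ` set xs"
  have subU: "submodule class_ring U V"
    using sub by (simp add: vec_subspace_def)
  interpret U: vectorspace class_ring "V\<lparr>carrier := U\<rparr>"
    by (rule subspace_is_vs) (use subU vec_vs in \<open>auto simp: VectorSpace.subspace_def\<close>)
  have cols: "cols ?X = map rat_vec xs"
    using True by (intro cols_mat_of_cols) auto
  have dist: "distinct (cols ?X) \<longleftrightarrow> distinct xs"
    unfolding cols by (auto simp: distinct_map inj_on_def dest: to_fract_hom.vec_hom_inj)
  have S: "?S \<subseteq> carrier_vec N"
    using True by auto
  have span: "span ?S = (\<lambda>c. ?X *\<^sub>v c) ` carrier_vec (length xs)"
  proof -
    have "span ?S = col_space ?X"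
      unfolding col_space_def cols by simp
    also have "\<dots> = (\<lambda>c. ?X *\<^sub>v c) ` carrier_vec (length xs)"
      unfolding col_space_eq[OF rat_cols_carrier]
      using mult_mat_vec_carrier[OF rat_cols_carrier] by auto
    finally show ?thesis .
  qed
  have basis: "vectorspace.basis class_ring (V\<lparr>carrier := U\<rparr>) ?S \<longleftrightarrow> lin_indpt ?S \<and> span ?S = U"
  proof (cases "?S \<subseteq> U")
    case True
    then show ?thesis
      unfolding U.basis_def using span_li_not_depend[OF True subU] by auto
  next
    case False
    then show ?thesis
      unfolding U.basis_def using in_own_span[OF S] by auto
  qed
  show ?thesis
    unfolding poly_basis_def basis injective_mat_iff_lin_indpt[OF rat_cols_carrier] dist span
    unfolding cols using True by auto
qed

lemma poly_basis_length_unique: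
  fixes U :: "'a::field poly fract vec set"
  assumes sub: "vec_subspace N U" and "poly_basis N U xs" "poly_basis N U ys"
  shows "length xs = length ys"
proof -
  interpret vec_space "TYPE('a poly fract)" N .
  interpret U: vectorspace class_ring "V\<lparr>carrier := U\<rparr>"
    by (rule subspace_is_vs) (use sub vec_vs in \<open>auto simp: VectorSpace.subspace_def vec_subspace_def\<close>)
  have "U.dim = length zs" if "poly_basis N U zs" for zs
  proof -
    have "card (rat_vec ` set zs) = card (set zs)"
      by (intro card_image) (auto simp: inj_on_def dest: to_fract_hom.vec_hom_inj)
    then show ?thesis
      using that U.dim_basis[of "rat_vec ` set zs"] by (simp add: poly_basis_def distinct_card)
  qed
  then show ?thesis using assms by metis
qed

lemma range_mult_square:
  fixes X S :: "'b::field mat"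
  assumes X: "X \<in> carrier_mat nr k" and S: "S \<in> carrier_mat k k" and inj: "injective_mat S"
  shows "(\<lambda>c. (X * S) *\<^sub>v c) ` carrier_vec k = (\<lambda>c. X *\<^sub>v c) ` carrier_vec k"
proof -
  obtain T where T: "T \<in> carrier_mat k k" "S * T = 1\<^sub>m k"
    using injective_square_inverse[OF S inj] by blast
  show ?thesis
  proof (intro equalityI subsetI; elim imageE)
    fix x c assume c: "x = X * S *\<^sub>v c" "c \<in> carrier_vec k"
    then have "x = X *\<^sub>v (S *\<^sub>v c)"
      using assoc_mult_mat_vec[OF X S] by simp
    moreover have "S *\<^sub>v c \<in> carrier_vec k"
      using S c by auto
    ultimately show "x \<in> (\<lambda>c. X *\<^sub>v c) ` carrier_vec k" by blast
  next
    fix x c assume c: "x = X *\<^sub>v c" "c \<in> carrier_vec k"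
    have Tc: "T *\<^sub>v c \<in> carrier_vec k"
      using T c by auto
    have "x = X * S *\<^sub>v (T *\<^sub>v c)"
      unfolding assoc_mult_mat_vec[OF X S Tc] assoc_mult_mat_vec[OF S T(1) c(2), symmetric] T(2)
      using c by simp
    with Tc show "x \<in> (\<lambda>c. X * S *\<^sub>v c) ` carrier_vec k" by blast
  qed
qed

lemma injective_mat_mult:
  fixes X S :: "'b::field mat"
  assumes X: "X \<in> carrier_mat nr k" "injective_mat X" and S: "S \<in> carrier_mat k l" "injective_mat S"
  shows "injective_mat (X * S)"
proof (rule injective_matI)
  fix v :: "'b vec" assume v: "v \<in> carrier_vec l" "X * S *\<^sub>v v = 0\<^sub>v nr"
  then have "X *\<^sub>v (S *\<^sub>v v) = 0\<^sub>v nr"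
    using assoc_mult_mat_vec[OF X(1) S(1)] by simp
  then have "S *\<^sub>v v = 0\<^sub>v k"
    using S v by (intro injective_matD[OF X(2,1)]) auto
  then show "v = 0\<^sub>v l"
    by (intro injective_matD[OF S(2,1) v(1)])
qed (use X S in auto)

text \<open>
  The exchange step. The new matrix of columns is the old one times a square matrix that is the
  identity except for column \<open>i\<close>, which is \<open>c\<close>; this factor is injective because \<open>c $ i \<noteq> 0\<close>.
\<close>
lemma poly_basis_exchange:
  fixes U :: "'a::field poly fract vec set"
  assumes sub: "vec_subspace N U" and basis: "poly_basis N U xs"
    and i: "i < length xs" and w: "w \<in> carrier_vec N"
    and c: "c \<in> carrier_vec (length xs)" "c $ i \<noteq> 0"
    and wc: "rat_vec w = rat_cols N xs *\<^sub>v c"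
  shows "poly_basis N U (xs[i := w])"
proof -
  let ?k = "length xs"
  let ?X = "rat_cols N xs"
  define S where "S = mat ?k ?k (\<lambda>(j, l). if l = i then c $ j else if j = l then 1 else 0)"
  have S: "S \<in> carrier_mat ?k ?k"
    by (simp add: S_def)
  note X = poly_basis_iff[OF sub, THEN iffD1, OF basis]
  have xs: "xs ! l \<in> carrier_vec N" if "l < ?k" for l
    using X that nth_mem by blast
  have new: "rat_cols N (xs[i := w]) = ?X * S"
  proof (rule mat_col_eqI)
    fix l assume "l < dim_col (?X * S)"
    then have l: "l < ?k" using S by simp
    have "col (?X * S) l = ?X *\<^sub>v col S l"
      using l by (intro col_mult2[OF rat_cols_carrier S])
    also have "\<dots> = rat_vec (xs[i := w] ! l)"
    proof (cases "l = i")
      case True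
      have "col S l = c"
        using True l c by (intro eq_vecI) (auto simp: S_def)
      then show ?thesis using True l wc by simp
    next
      case False
      have "col S l = unit_vec ?k l"
        using False l by (intro eq_vecI) (auto simp: S_def unit_vec_def)
      then show ?thesis
        using False l xs[OF l] mult_unit_vec[OF rat_cols_carrier l, of N] by simp
    qed
    also have "\<dots> = col (rat_cols N (xs[i := w])) l"
      using l xs[OF l] w i by (subst col_rat_cols) (auto simp: nth_list_update)
    finally show "col (rat_cols N (xs[i := w])) l = col (?X * S) l" ..
  qed (use S in auto)
  have "injective_mat S"
  proof (rule injective_matI[OF S])
    fix a assume a: "a \<in> carrier_vec ?k" "S *\<^sub>v a = 0\<^sub>v ?k"
    have Sa: "(S *\<^sub>v a) $ j = a $ i * c $ j + (if j = i then 0 else a $ j)" if j: "j < ?k" for j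
    proof -
      have "(S *\<^sub>v a) $ j = (\<Sum>l<?k. (if l = i then c $ j else if j = l then 1 else 0) * a $ l)"
        using j a(1) by (simp add: S_def scalar_prod_def atLeast0LessThan)
      also have "\<dots> = (\<Sum>l<?k. (if l = i then a $ i * c $ j else 0) +
          (if l = j then (if j = i then 0 else a $ j) else 0))"
        by (intro sum.cong) auto
      also have "\<dots> = a $ i * c $ j + (if j = i then 0 else a $ j)"
        using i j by (simp add: sum.distrib)
      finally show ?thesis .
    qed
    have "a $ i = 0"
      using Sa[OF i] a(2) i c(2) by simp
    then have "a $ j = 0" if "j < ?k" for j
      using Sa[OF that] that a(2) by (cases "j = i") simp_all
    then show "a = 0\<^sub>v ?k"
      using a(1) by (intro eq_vecI) auto
  qed
  then have "injective_mat (?X * S)"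
      "(\<lambda>c. ?X * S *\<^sub>v c) ` carrier_vec ?k = (\<lambda>c. ?X *\<^sub>v c) ` carrier_vec ?k"
    using X injective_mat_mult[OF rat_cols_carrier _ S] range_mult_square[OF rat_cols_carrier S]
    by metis+
  moreover have "set (xs[i := w]) \<subseteq> carrier_vec N"
    using set_update_subset_insert[of xs i w] X w by blast
  ultimately show ?thesis
    unfolding poly_basis_iff[OF sub] new length_list_update using X by metis
qed

text \<open>
  Otherwise the exchange of \<open>xs ! i\<close> for \<open>w\<close> would lower the sum of degrees. All properties of
  minimal bases are derived from this comparison.
\<close>
lemma minimal_basis_degree_le:
  fixes U :: "'a::field poly fract vec set"
  assumes sub: "vec_subspace N U" and basis: "minimal_basis N U xs"
    and i: "i < length xs" and w: "w \<in> carrier_vec N"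
    and c: "c \<in> carrier_vec (length xs)" "c $ i \<noteq> 0"
    and wc: "rat_vec w = rat_cols N xs *\<^sub>v c"
  shows "vec_degree (xs ! i) \<le> vec_degree w"
proof -
  have "poly_basis N U (xs[i := w])"
    using poly_basis_exchange[OF sub _ i w c wc] basis by (simp add: minimal_basis_def)
  then have "(\<Sum>x\<leftarrow>xs. vec_degree x) \<le> (\<Sum>y\<leftarrow>xs[i := w]. vec_degree y)"
    using basis by (simp add: minimal_basis_def)
  also have "\<dots> = (\<Sum>x\<leftarrow>xs. vec_degree x) + vec_degree w - vec_degree (xs ! i)"
    using i by (simp add: map_update sum_list_update)
  finally show ?thesis
    using i elem_le_sum_list[of i "map vec_degree xs"] by simp
qed

section \<open>Degrees and leading coefficients\<close>

lemma vec_degree_le_iff: "vec_degree v \<le> d \<longleftrightarrow> (\<forall>i<dim_vec v. degree (v $ i) \<le> d)"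
proof -
  have "finite {degree (v $ i) | i. i < dim_vec v}"
    by (rule finite_image_set) simp
  then show ?thesis
    unfolding vec_degree_def by (subst Max_le_iff) auto
qed

lemma degree_le_vec_degree: "i < dim_vec v \<Longrightarrow> degree (v $ i) \<le> vec_degree v"
  using vec_degree_le_iff[of v "vec_degree v"] by simp

lemma mat_degree_le_iff:
  "mat_degree P \<le> d \<longleftrightarrow> (\<forall>i<dim_row P. \<forall>j<dim_col P. degree (P $$ (i, j)) \<le> d)"
proof -
  have "finite ((\<lambda>(i, j). degree (P $$ (i, j))) ` ({..<dim_row P} \<times> {..<dim_col P}))"
    by simp
  also have "(\<lambda>(i, j). degree (P $$ (i, j))) ` ({..<dim_row P} \<times> {..<dim_col P}) =
      {degree (P $$ (i, j)) | i j. i < dim_row P \<and> j < dim_col P}"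
    by auto
  finally show ?thesis
    unfolding mat_degree_def by (subst Max_le_iff) auto
qed

lemma linear_mat_iff_mat_degree: "linear_mat P \<longleftrightarrow> mat_degree P \<le> 1"
  by (simp add: linear_mat_def mat_degree_le_iff)

lemma mat_degree_transpose [simp]: "mat_degree P\<^sup>T = mat_degree P"
proof -
  have *: "mat_degree P\<^sup>T \<le> d \<longleftrightarrow> mat_degree P \<le> d" for d
    unfolding mat_degree_le_iff by auto
  show ?thesis
    using *[of "mat_degree P"] *[of "mat_degree P\<^sup>T"] by simp
qed

lemma mat_degree_append_rows:
  assumes P: "P \<in> carrier_mat r1 c" and Q: "Q \<in> carrier_mat r2 c"
  shows "mat_degree (P @\<^sub>r Q) \<le> d \<longleftrightarrow> mat_degree P \<le> d \<and> mat_degree Q \<le> d"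
proof -
  have entry: "(P @\<^sub>r Q) $$ (i, j) = (if i < r1 then P $$ (i, j) else Q $$ (i - r1, j))"
    if "i < r1 + r2" "j < c" for i j
    using that P Q by (simp add: append_rows_def)
  have "(P @\<^sub>r Q) \<in> carrier_mat (r1 + r2) c"
    using P Q by simp
  then have "mat_degree (P @\<^sub>r Q) \<le> d \<longleftrightarrow>
      (\<forall>i<r1 + r2. \<forall>j<c. degree (if i < r1 then P $$ (i, j) else Q $$ (i - r1, j)) \<le> d)"
    unfolding mat_degree_le_iff using entry by auto
  also have "\<dots> \<longleftrightarrow> (\<forall>i<r1. \<forall>j<c. degree (P $$ (i, j)) \<le> d) \<and>
      (\<forall>i<r2. \<forall>j<c. degree (Q $$ (i, j)) \<le> d)"
    (is "?l \<longleftrightarrow> ?r")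
  proof
    assume l: ?l
    show ?r
    proof (intro conjI allI impI)
      fix i j assume "i < r1" "j < c"
      then show "degree (P $$ (i, j)) \<le> d" using l[rule_format, of i j] by simp
    next
      fix i j assume "i < r2" "j < c"
      then show "degree (Q $$ (i, j)) \<le> d" using l[rule_format, of "r1 + i" j] by simp
    qed
  qed auto
  finally show ?thesis
    using P Q by (simp add: mat_degree_le_iff)
qed

lemma vec_degree_append:
  "vec_degree (v @\<^sub>v w) = max (vec_degree v) (vec_degree w)"
proof -
  have *: "vec_degree (v @\<^sub>v w) \<le> d \<longleftrightarrow> vec_degree v \<le> d \<and> vec_degree w \<le> d" for d
  proof (intro iffI conjI)
    assume l: "vec_degree (v @\<^sub>v w) \<le> d"
    then have l: "degree ((v @\<^sub>v w) $ i) \<le> d" if "i < dim_vec v + dim_vec w" for i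
      using that by (simp add: vec_degree_le_iff)
    show "vec_degree v \<le> d"
      unfolding vec_degree_le_iff
    proof (intro allI impI)
      fix i assume "i < dim_vec v"
      then show "degree (v $ i) \<le> d" using l[of i] by simp
    qed
    show "vec_degree w \<le> d"
      unfolding vec_degree_le_iff
    proof (intro allI impI)
      fix i assume "i < dim_vec w"
      then show "degree (w $ i) \<le> d" using l[of "dim_vec v + i"] by simp
    qed
  qed (auto simp: vec_degree_le_iff)
  show ?thesis
  proof (rule antisym)
    show "vec_degree (v @\<^sub>v w) \<le> max (vec_degree v) (vec_degree w)"
      by (rule *[THEN iffD2]) simp
    show "max (vec_degree v) (vec_degree w) \<le> vec_degree (v @\<^sub>v w)"
      using *[THEN iffD1, OF order_refl] by (intro max.boundedI) blast+
  qed
qed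

definition coeff_mat :: "nat \<Rightarrow> 'a::zero poly mat \<Rightarrow> 'a mat" where
  "coeff_mat k P = map_mat (\<lambda>p. coeff p k) P"

definition coeff_vec :: "nat \<Rightarrow> 'a::zero poly vec \<Rightarrow> 'a vec" where
  "coeff_vec k v = map_vec (\<lambda>p. coeff p k) v"

lemma coeff_mat_carrier [simp]: "coeff_mat k P \<in> carrier_mat nr nc \<longleftrightarrow> P \<in> carrier_mat nr nc"
  by (auto simp: coeff_mat_def)

lemma coeff_vec_carrier [simp]: "coeff_vec k v \<in> carrier_vec n \<longleftrightarrow> v \<in> carrier_vec n"
  by (simp add: coeff_vec_def)

lemma coeff_mat_append_rows:
  assumes "P \<in> carrier_mat r1 c" "Q \<in> carrier_mat r2 c"
  shows "coeff_mat k (P @\<^sub>r Q) = coeff_mat k P @\<^sub>r coeff_mat k Q"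
  using assms by (intro eq_matI) (auto simp: append_rows_def coeff_mat_def)

text \<open>
  In the convolution sum every other term has a factor whose index exceeds its degree bound.
\<close>
lemma coeff_mult_at_degree_bounds:
  fixes p q :: "'a::comm_semiring_0 poly"
  assumes "degree p \<le> a" "degree q \<le> b"
  shows "coeff (p * q) (a + b) = coeff p a * coeff q b"
proof -
  have "coeff (p * q) (a + b) = (\<Sum>i\<le>a + b. coeff p i * coeff q (a + b - i))"
    by (rule coeff_mult)
  also have "\<dots> = (\<Sum>i\<le>a + b. if i = a then coeff p a * coeff q b else 0)"
  proof (intro sum.cong refl)
    fix i
    show "coeff p i * coeff q (a + b - i) = (if i = a then coeff p a * coeff q b else 0)"
    proof (cases i a rule: linorder_cases)
      case less
      then show ?thesis using assms by (simp add: coeff_eq_0)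
    next
      case greater
      then show ?thesis using assms by (simp add: coeff_eq_0)
    qed simp
  qed
  also have "\<dots> = coeff p a * coeff q b"
    by simp
  finally show ?thesis .
qed

lemma vec_degree_mult_le:
  fixes P :: "'a::comm_semiring_0 poly mat"
  assumes "P \<in> carrier_mat nr nc" "v \<in> carrier_vec nc" "mat_degree P \<le> g" "vec_degree v \<le> d"
  shows "vec_degree (P *\<^sub>v v) \<le> g + d"
proof -
  have "degree ((P *\<^sub>v v) $ i) \<le> g + d" if i: "i < nr" for i
  proof -
    have "degree (P $$ (i, j) * v $ j) \<le> g + d" if "j < nc" for j
      using that i assms
      by (intro order_trans[OF degree_mult_le] add_mono) (auto simp: mat_degree_le_iff vec_degree_le_iff)
    then show ?thesis
      using i assms by (auto simp: scalar_prod_def intro!: degree_sum_le)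
  qed
  then show ?thesis
    using assms by (simp add: vec_degree_le_iff)
qed

lemma coeff_vec_mult:
  fixes P :: "'a::comm_semiring_0 poly mat"
  assumes "P \<in> carrier_mat nr nc" "v \<in> carrier_vec nc" "mat_degree P \<le> g" "vec_degree v \<le> d"
  shows "coeff_vec (g + d) (P *\<^sub>v v) = coeff_mat g P *\<^sub>v coeff_vec d v"
proof (rule eq_vecI)
  fix i assume "i < dim_vec (coeff_mat g P *\<^sub>v coeff_vec d v)"
  then have i: "i < nr" using assms by (simp add: coeff_mat_def)
  have "coeff (\<Sum>j<nc. P $$ (i, j) * v $ j) (g + d) = (\<Sum>j<nc. coeff (P $$ (i, j)) g * coeff (v $ j) d)"
    unfolding coeff_sum
    using i assms by (intro sum.cong refl coeff_mult_at_degree_bounds)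
      (auto simp: mat_degree_le_iff vec_degree_le_iff)
  then show "coeff_vec (g + d) (P *\<^sub>v v) $ i = (coeff_mat g P *\<^sub>v coeff_vec d v) $ i"
    using i assms by (simp add: coeff_vec_def coeff_mat_def scalar_prod_def atLeast0LessThan)
qed (use assms in \<open>simp add: coeff_vec_def coeff_mat_def\<close>)

lemma leading_coeff_vec_nonzero:
  assumes "v \<in> carrier_vec n" "v \<noteq> 0\<^sub>v n"
  shows "coeff_vec (vec_degree v) v \<noteq> 0\<^sub>v n"
proof -
  obtain i where i: "i < n" "v $ i \<noteq> 0" "degree (v $ i) = vec_degree v"
  proof (cases "vec_degree v = 0")
    case True
    obtain i where "i < n" "v $ i \<noteq> 0"
      using assms by (auto simp: vec_eq_iff)
    then show thesis
      using that True degree_le_vec_degree[of i v] assms by simp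
  next
    case False
    have "finite {degree (v $ i) | i. i < dim_vec v}"
      by (rule finite_image_set) simp
    then have "vec_degree v \<in> insert 0 {degree (v $ i) | i. i < dim_vec v}"
      unfolding vec_degree_def by (intro Max_in) auto
    with False obtain i where "i < dim_vec v" "degree (v $ i) = vec_degree v"
      by auto
    moreover from this False have "v $ i \<noteq> 0"
      by auto
    ultimately show thesis using that assms by simp
  qed
  then have "coeff_vec (vec_degree v) v $ i \<noteq> 0"
    using assms by (simp add: coeff_vec_def flip: i(3))
  then show ?thesis using i by auto
qed

text \<open>
  The predictable degree property: the coefficient of \<open>P *\<^sub>v v\<close> at the largest possible degree is the
  leading coefficient vector of \<open>v\<close> times an injective matrix, and so it does not vanish.
\<close>
lemma vec_degree_mult_eq:
  fixes P :: "'a::comm_ring_1 poly mat"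
  assumes P: "P \<in> carrier_mat nr nc" "mat_degree P \<le> g" "injective_mat (coeff_mat g P)"
    and v: "v \<in> carrier_vec nc" "v \<noteq> 0\<^sub>v nc"
  shows "vec_degree (P *\<^sub>v v) = g + vec_degree v"
proof (rule antisym)
  show "vec_degree (P *\<^sub>v v) \<le> g + vec_degree v"
    by (rule vec_degree_mult_le[OF P(1) v(1) P(2) order_refl])
  show "g + vec_degree v \<le> vec_degree (P *\<^sub>v v)"
  proof (rule ccontr)
    assume less: "\<not> g + vec_degree v \<le> vec_degree (P *\<^sub>v v)"
    have "coeff_vec (g + vec_degree v) (P *\<^sub>v v) = 0\<^sub>v nr"
    proof (rule eq_vecI)
      fix i assume "i < dim_vec (0\<^sub>v nr :: 'a vec)"
      then have i: "i < nr" "i < dim_vec (P *\<^sub>v v)" using P(1) by auto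
      have "degree ((P *\<^sub>v v) $ i) < g + vec_degree v"
        using less degree_le_vec_degree[OF i(2)] by linarith
      then show "coeff_vec (g + vec_degree v) (P *\<^sub>v v) $ i = 0\<^sub>v nr $ i"
        using i unfolding coeff_vec_def by (subst index_map_vec(1)) (auto intro: coeff_eq_0)
    qed (use P(1) in \<open>simp add: coeff_vec_def\<close>)
    then have "coeff_mat g P *\<^sub>v coeff_vec (vec_degree v) v = 0\<^sub>v nr"
      using coeff_vec_mult[OF P(1) v(1) P(2) order_refl] by simp
    then have "coeff_vec (vec_degree v) v = 0\<^sub>v nc"
      using P(1) v(1) by (intro injective_matD[OF P(3), of nr nc]) simp_all
    then show False
      using leading_coeff_vec_nonzero[OF v] by simp
  qed
qed

section \<open>Evaluation and polynomial solutions\<close>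

definition eval_vec :: "'a::comm_semiring_0 poly vec \<Rightarrow> 'a \<Rightarrow> 'a vec" where
  "eval_vec v x = map_vec (\<lambda>q. poly q x) v"

lemma eval_vec_carrier [simp]: "eval_vec v z \<in> carrier_vec n \<longleftrightarrow> v \<in> carrier_vec n"
  by (simp add: eval_vec_def)

lemma eval_mat_carrier [simp]: "eval_mat P z \<in> carrier_mat nr nc \<longleftrightarrow> P \<in> carrier_mat nr nc"
  by (auto simp: eval_mat_def)

lemma eval_mat_append_rows:
  assumes "P \<in> carrier_mat r1 c" "Q \<in> carrier_mat r2 c"
  shows "eval_mat (P @\<^sub>r Q) z = eval_mat P z @\<^sub>r eval_mat Q z"
  using assms by (intro eq_matI) (auto simp: append_rows_def eval_mat_def)

lemma eval_mat_mult_vec: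
  fixes P :: "'a::comm_ring_1 poly mat"
  assumes "P \<in> carrier_mat nr nc" "v \<in> carrier_vec nc"
  shows "eval_vec (P *\<^sub>v v) z = eval_mat P z *\<^sub>v eval_vec v z"
proof -
  have "semiring_hom (\<lambda>q::'a poly. poly q z)"
    by unfold_locales auto
  then show ?thesis
    unfolding eval_vec_def eval_mat_def by (rule semiring_hom.mult_mat_vec_hom[OF _ assms])
qed

lemma eval_vec_zero_divisible:
  fixes v :: "'a::field poly vec"
  assumes v: "v \<in> carrier_vec n" and "eval_vec v z = 0\<^sub>v n"
  obtains w where "w \<in> carrier_vec n" "v = [:- z, 1:] \<cdot>\<^sub>v w"
proof -
  have dvd: "[:- z, 1:] dvd v $ i" if i: "i < n" for i
  proof -
    have "eval_vec v z $ i = 0" using assms i by simp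
    then show ?thesis
      using v i by (simp add: eval_vec_def poly_eq_0_iff_dvd)
  qed
  have "v = [:- z, 1:] \<cdot>\<^sub>v map_vec (\<lambda>q. q div [:- z, 1:]) v"
  proof (rule eq_vecI)
    fix i assume "i < dim_vec ([:- z, 1:] \<cdot>\<^sub>v map_vec (\<lambda>q. q div [:- z, 1:]) v)"
    then have i: "i < dim_vec v" "i < n" using v by auto
    then show "v $ i = ([:- z, 1:] \<cdot>\<^sub>v map_vec (\<lambda>q. q div [:- z, 1:]) v) $ i"
      using dvd_mult_div_cancel[OF dvd[OF i(2)]]
      by (simp del: mult_pCons_left)
  qed simp
  then show thesis
    using v by (intro that[of "map_vec (\<lambda>q. q div [:- z, 1:]) v"]) auto
qed

text \<open>
  The product of the denominators of the entries will do.
\<close>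
lemma common_denominator:
  fixes u :: "'a::field poly fract vec"
  obtains d a where "d \<noteq> 0" "a \<in> carrier_vec (dim_vec u)" "to_fract d \<cdot>\<^sub>v u = rat_vec a"
proof -
  have ex: "\<exists>d. d \<noteq> 0 \<and> (\<forall>i<k. to_fract d * u $ i \<in> range to_fract)" for k
  proof (induction k)
    case 0
    then show ?case by (intro exI[of _ 1]) auto
  next
    case (Suc k)
    then obtain d where d: "d \<noteq> 0" "\<forall>i<k. to_fract d * u $ i \<in> range to_fract" by blast
    obtain a b where ab: "u $ k = Fraction_Field.Fract a b" "b \<noteq> 0"
      by (cases "u $ k") auto
    show ?case
    proof (intro exI[of _ "d * b"] conjI allI impI)
      fix i assume i: "i < Suc k"
      show "to_fract (d * b) * u $ i \<in> range to_fract"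
      proof (cases "i = k")
        case True
        have "to_fract b * u $ k = to_fract a"
          using ab by (simp add: Fract_conv_to_fract)
        then have "to_fract (d * b) * u $ i = to_fract (d * a)"
          using True by (simp add: mult.assoc)
        then show ?thesis by (metis rangeI)
      next
        case False
        then have "to_fract d * u $ i \<in> range to_fract" using d(2) i by simp
        then obtain c where "to_fract d * u $ i = to_fract c" by blast
        then have "to_fract (d * b) * u $ i = to_fract (b * c)"
          by (simp add: mult_ac)
        then show ?thesis by (metis rangeI)
      qed
    qed (use d ab in auto)
  qed
  obtain d where d: "d \<noteq> 0" "\<forall>i<dim_vec u. to_fract d * u $ i \<in> range to_fract"
    using ex[of "dim_vec u"] by (elim exE conjE)
  have "\<forall>i. \<exists>c. i < dim_vec u \<longrightarrow> to_fract d * u $ i = to_fract c"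
    using d(2) by (simp add: image_iff)
  then obtain f where f: "\<forall>i. i < dim_vec u \<longrightarrow> to_fract d * u $ i = to_fract (f i)"
    by (rule choice[THEN exE])
  then have "to_fract d \<cdot>\<^sub>v u = rat_vec (vec (dim_vec u) f)"
    by (intro eq_vecI) auto
  then show thesis
    by (intro that[OF d(1)]) simp_all
qed

text \<open>
  Linear factors of a common denominator \<open>d\<close> of \<open>u\<close> can be cancelled one at a time: with
  \<open>a = d u\<close> and a root \<open>z\<close> of \<open>d\<close>, the polynomial identity \<open>P a = d x\<close> shows that the value of \<open>a\<close> at
  \<open>z\<close> is in the kernel of the value of \<open>P\<close>, so \<open>a\<close> is divisible by \<open>[:- z, 1:]\<close> too.
\<close>
lemma polynomial_of_polynomial_image:
  fixes P :: "'a::alg_closed_field poly mat"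
  assumes P: "P \<in> carrier_mat nr nc" and inj: "\<And>z. injective_mat (eval_mat P z)"
    and u: "u \<in> carrier_vec nc" and Pu: "rat_mat P *\<^sub>v u = rat_vec x"
  obtains v where "v \<in> carrier_vec nc" "u = rat_vec v"
proof -
  have x: "x \<in> carrier_vec nr"
    using arg_cong[OF Pu, of dim_vec] P by (intro carrier_vecI) simp
  have "\<exists>v\<in>carrier_vec nc. u = rat_vec v"
    if "to_fract d \<cdot>\<^sub>v u = rat_vec a" "d \<noteq> 0" "a \<in> carrier_vec nc" for d a
    using that
  proof (induction "degree d" arbitrary: d a rule: less_induct)
    case less
    show ?case
    proof (cases "degree d = 0")
      case True
      then obtain c where c: "d = [:c:]" "c \<noteq> 0"
        using less.prems(2) by (metis degree_eq_zeroE pCons_0_0)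
      have "u = rat_vec ([:inverse c:] \<cdot>\<^sub>v a)"
      proof -
        have "rat_vec ([:inverse c:] \<cdot>\<^sub>v a) = to_fract [:inverse c:] \<cdot>\<^sub>v (to_fract d \<cdot>\<^sub>v u)"
          unfolding less.prems(1) by (rule to_fract_hom.vec_hom_smult)
        also have "\<dots> = to_fract ([:inverse c:] * d) \<cdot>\<^sub>v u"
          by (simp only: smult_smult_assoc to_fract_mult)
        also have "[:inverse c:] * d = 1"
          using c by simp
        finally show ?thesis by simp
      qed
      with less.prems show ?thesis by (intro bexI[of _ "[:inverse c:] \<cdot>\<^sub>v a"]) auto
    next
      case False
      then obtain z where z: "poly d z = 0"
        using alg_closed_imp_poly_has_root[of d] by auto
      then obtain d' where d': "d = [:- z, 1:] * d'"
        by (metis dvdE poly_eq_0_iff_dvd)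
      \<comment> \<open>The identity \<open>P a = d x\<close> is obtained over the rational functions, where \<open>u\<close> lives.\<close>
      have "rat_vec (P *\<^sub>v a) = rat_mat P *\<^sub>v (to_fract d \<cdot>\<^sub>v u)"
        unfolding less.prems(1) using P less.prems by (intro to_fract_hom.mult_mat_vec_hom)
      also have "\<dots> = to_fract d \<cdot>\<^sub>v (rat_mat P *\<^sub>v u)"
        using P u by (intro mult_mat_vec) auto
      also have "\<dots> = rat_vec (d \<cdot>\<^sub>v x)"
        unfolding Pu by (rule to_fract_hom.vec_hom_smult[symmetric])
      finally have "P *\<^sub>v a = d \<cdot>\<^sub>v x"
        by (rule to_fract_hom.vec_hom_inj)
      then have "eval_mat P z *\<^sub>v eval_vec a z = eval_vec (d \<cdot>\<^sub>v x) z"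
        using eval_mat_mult_vec[OF P less.prems(3)] by metis
      also have "\<dots> = 0\<^sub>v nr"
        using x z by (intro eq_vecI) (auto simp: eval_vec_def)
      finally have "eval_vec a z = 0\<^sub>v nc"
        using P less.prems(3) by (intro injective_matD[OF inj, of z nr nc]) simp_all
      then obtain b where b: "b \<in> carrier_vec nc" "a = [:- z, 1:] \<cdot>\<^sub>v b"
        using eval_vec_zero_divisible[OF less.prems(3)] by blast
      have "to_fract [:- z, 1:] \<cdot>\<^sub>v (to_fract d' \<cdot>\<^sub>v u) = to_fract [:- z, 1:] \<cdot>\<^sub>v rat_vec b"
        using less.prems(1) unfolding d' b(2) to_fract_hom.vec_hom_smult
        by (simp only: smult_smult_assoc to_fract_mult)
      then have "to_fract d' \<cdot>\<^sub>v u = rat_vec b"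
        using u b(1) by (auto simp: vec_eq_iff)
      moreover have "d' \<noteq> 0" "degree d' < degree d"
        using less.prems(2) degree_mult_eq[of "[:- z, 1:]" d'] unfolding d'
        by (auto simp del: mult_pCons_left)
      ultimately show ?thesis
        using less.hyps b(1) by blast
    qed
  qed
  then show thesis
    using common_denominator[of u] u that by (metis carrier_vecD)
qed

section \<open>Minimal bases with equal row degrees\<close>

lemma rat_cols_rows:
  assumes "N \<in> carrier_mat q l"
  shows "rat_cols l (rows N) = rat_mat N\<^sup>T"
proof (rule eq_matI)
  fix i j assume "i < dim_row (rat_mat N\<^sup>T)" "j < dim_col (rat_mat N\<^sup>T)"
  then have "i < l" "j < q" using assms by auto
  then show "rat_cols l (rows N) $$ (i, j) = rat_mat N\<^sup>T $$ (i, j)"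
    using assms by (simp add: mat_of_cols_index)
qed (use assms in auto)

context
  fixes N :: "'a::field poly mat" and q l \<rho> :: nat
  assumes N: "N \<in> carrier_mat q l" and min: "minimal_basis_mat N"
begin

lemma minimal_basis_mat_injective: "injective_mat (rat_mat N\<^sup>T)"
proof -
  have "poly_basis l (vec_space.row_space l (rat_mat N)) (rows N)"
    using min N by (simp add: minimal_basis_mat_def minimal_basis_def)
  moreover have "vec_subspace l (vec_space.row_space l (rat_mat N))"
    using N by (intro vec_subspace_row_space[of _ q]) simp
  ultimately show ?thesis
    using poly_basis_iff rat_cols_rows[OF N] by metis
qed

lemma minimal_basis_mat_degree_le:
  assumes w: "w \<in> carrier_vec l" and c: "c \<in> carrier_vec q" "i < q" "c $ i \<noteq> 0"
    and wc: "rat_vec w = rat_mat N\<^sup>T *\<^sub>v c"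
  shows "row_degree N i \<le> vec_degree w"
proof -
  have "minimal_basis l (vec_space.row_space l (rat_mat N)) (rows N)"
    using min N by (simp add: minimal_basis_mat_def)
  moreover have "vec_subspace l (vec_space.row_space l (rat_mat N))"
    using N by (intro vec_subspace_row_space[of _ q]) simp
  ultimately have "vec_degree (rows N ! i) \<le> vec_degree w"
    using minimal_basis_degree_le[of l _ "rows N" i w c] rat_cols_rows[OF N] w c wc N by auto
  then show ?thesis using c N by simp
qed

context
  assumes deg: "mat_degree N \<le> \<rho>" "\<And>i. i < q \<Longrightarrow> row_degree N i = \<rho>" and pos: "0 < \<rho>"
begin

text \<open>
  Linear dependences between the values, or between the leading coefficients, of the rows of \<open>N\<close> have
  constant coefficients. They are compared with the combination of the rows themselves with the same
  coefficients, regarded as constant polynomials.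
\<close>
lemma constant_combination:
  fixes c :: "'a vec"
  assumes c: "c \<in> carrier_vec q"
  defines "a \<equiv> map_vec (\<lambda>x. [:x:]) c"
  shows "a \<in> carrier_vec q" "vec_degree (N\<^sup>T *\<^sub>v a) \<le> \<rho>"
    "coeff_vec \<rho> (N\<^sup>T *\<^sub>v a) = coeff_mat \<rho> N\<^sup>T *\<^sub>v c"
    "eval_vec (N\<^sup>T *\<^sub>v a) z = eval_mat N\<^sup>T z *\<^sub>v c"
    "rat_vec (N\<^sup>T *\<^sub>v a) = rat_mat N\<^sup>T *\<^sub>v rat_vec a"
proof -
  show a: "a \<in> carrier_vec q"
    using c by (simp add: a_def)
  have NT: "N\<^sup>T \<in> carrier_mat l q"
    using N by simp
  have a0: "vec_degree a \<le> 0"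
    unfolding vec_degree_le_iff by (simp add: a_def)
  have degT: "mat_degree N\<^sup>T \<le> \<rho>"
    using deg by simp
  show "vec_degree (N\<^sup>T *\<^sub>v a) \<le> \<rho>"
    using vec_degree_mult_le[OF NT a degT a0] by simp
  have "coeff_vec 0 a = c" "eval_vec a z = c"
    by (auto simp: a_def coeff_vec_def eval_vec_def intro!: eq_vecI)
  then show "coeff_vec \<rho> (N\<^sup>T *\<^sub>v a) = coeff_mat \<rho> N\<^sup>T *\<^sub>v c"
    "eval_vec (N\<^sup>T *\<^sub>v a) z = eval_mat N\<^sup>T z *\<^sub>v c"
    using coeff_vec_mult[OF NT a degT a0] eval_mat_mult_vec[OF NT a, of z] by simp_all
  show "rat_vec (N\<^sup>T *\<^sub>v a) = rat_mat N\<^sup>T *\<^sub>v rat_vec a"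
    by (rule to_fract_hom.mult_mat_vec_hom[OF NT a])
qed

text \<open>
  If the leading coefficients of the rows were dependent, the same combination of the rows would have
  degree below \<open>\<rho>\<close> and could replace one of them.
\<close>
lemma minimal_basis_leading_coeff_injective: "injective_mat (coeff_mat \<rho> N\<^sup>T)"
proof (rule injective_matI)
  show "coeff_mat \<rho> N\<^sup>T \<in> carrier_mat l q"
    using N by simp
  fix c :: "'a vec" assume c: "c \<in> carrier_vec q" "coeff_mat \<rho> N\<^sup>T *\<^sub>v c = 0\<^sub>v l"
  show "c = 0\<^sub>v q"
  proof (rule ccontr)
    assume "c \<noteq> 0\<^sub>v q"
    then obtain i where i: "i < q" "c $ i \<noteq> 0"
      using c(1) by (metis carrier_vecD eq_vecI index_zero_vec)
    define a where "a = map_vec (\<lambda>x. [:x:]) c"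
    note const = constant_combination[OF c(1), folded a_def]
    let ?w = "N\<^sup>T *\<^sub>v a"
    have "vec_degree ?w \<le> \<rho> - 1"
      unfolding vec_degree_le_iff
    proof (intro allI impI)
      fix j assume j: "j < dim_vec ?w"
      have "coeff_vec \<rho> ?w $ j = 0"
        using const(3) c(2) j N by simp
      then have "coeff (?w $ j) \<rho> = 0"
        using j by (simp add: coeff_vec_def)
      moreover have "degree (?w $ j) \<le> \<rho>"
        using const(2) j by (simp add: vec_degree_le_iff)
      ultimately have "degree (?w $ j) \<noteq> \<rho>"
        using pos by (metis degree_0 leading_coeff_0_iff less_numeral_extra(3))
      then show "degree (?w $ j) \<le> \<rho> - 1"
        using \<open>degree (?w $ j) \<le> \<rho>\<close> by linarith
    qed
    moreover have "row_degree N i \<le> vec_degree ?w"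
      using const(5) i c(1) N
      by (intro minimal_basis_mat_degree_le[of _ "rat_vec a"])
        (auto simp: a_def intro!: mult_mat_vec_carrier)
    ultimately show False
      using deg(2)[OF i(1)] pos by simp
  qed
qed

text \<open>
  If the values of the rows at \<open>z\<close> were dependent, the same combination of the rows would be divisible
  by \<open>[:- z, 1:]\<close>, and the quotient, whose degree is below \<open>\<rho>\<close>, could replace one of them.
\<close>
lemma minimal_basis_eval_injective: "injective_mat (eval_mat N\<^sup>T z)"
proof (rule injective_matI)
  show "eval_mat N\<^sup>T z \<in> carrier_mat l q"
    using N by simp
  fix c :: "'a vec" assume c: "c \<in> carrier_vec q" "eval_mat N\<^sup>T z *\<^sub>v c = 0\<^sub>v l"
  show "c = 0\<^sub>v q"
  proof (rule ccontr)
    assume "c \<noteq> 0\<^sub>v q"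
    then obtain i where i: "i < q" "c $ i \<noteq> 0"
      using c(1) by (metis carrier_vecD eq_vecI index_zero_vec)
    define a where "a = map_vec (\<lambda>x. [:x:]) c"
    note const = constant_combination[OF c(1), folded a_def]
    have "N\<^sup>T *\<^sub>v a \<in> carrier_vec l"
      using N const(1) by (intro mult_mat_vec_carrier) auto
    moreover have "eval_vec (N\<^sup>T *\<^sub>v a) z = 0\<^sub>v l"
      using const(4) c(2) by simp
    ultimately obtain w where w: "w \<in> carrier_vec l" "N\<^sup>T *\<^sub>v a = [:- z, 1:] \<cdot>\<^sub>v w"
      by (rule eval_vec_zero_divisible)
    have "vec_degree w \<le> \<rho> - 1"
      unfolding vec_degree_le_iff
    proof (intro allI impI)
      fix j assume j: "j < dim_vec w"
      have "degree ([:- z, 1:] * w $ j) \<le> \<rho>"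
        using const(2) j unfolding w(2) by (simp add: vec_degree_le_iff del: mult_pCons_left)
      moreover have "degree ([:- z, 1:] * w $ j) = Suc (degree (w $ j))" if "w $ j \<noteq> 0"
        using degree_mult_eq[of "[:- z, 1:]" "w $ j"] that by (simp del: mult_pCons_left)
      ultimately show "degree (w $ j) \<le> \<rho> - 1"
        by (cases "w $ j = 0") simp_all
    qed
    moreover have "row_degree N i \<le> vec_degree w"
    proof (rule minimal_basis_mat_degree_le[OF w(1)])
      \<comment> \<open>Division by \<open>[:- z, 1:]\<close> turns the constant coefficients into rational ones.\<close>
      let ?d = "to_fract [:- z, 1:] :: 'a poly fract"
      have "?d \<noteq> 0"
        by (simp only: to_fract_eq_0_iff) simp
      have "rat_mat N\<^sup>T *\<^sub>v (inverse ?d \<cdot>\<^sub>v rat_vec a) = inverse ?d \<cdot>\<^sub>v rat_vec (N\<^sup>T *\<^sub>v a)"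
        unfolding const(5) using N const(1) by (intro mult_mat_vec) auto
      also have "\<dots> = rat_vec w"
        unfolding w(2) to_fract_hom.vec_hom_smult smult_smult_assoc
        using \<open>?d \<noteq> 0\<close> by simp
      finally show "rat_vec w = rat_mat N\<^sup>T *\<^sub>v (inverse ?d \<cdot>\<^sub>v rat_vec a)" ..
      show "(inverse ?d \<cdot>\<^sub>v rat_vec a) $ i \<noteq> 0"
        using i c(1) \<open>?d \<noteq> 0\<close> by (simp add: a_def del: to_fract_hom.hom_minus)
    qed (use const(1) i in auto)
    ultimately show False
      using deg(2)[OF i(1)] pos by simp
  qed
qed

end

end

section \<open>Values of reversals at zero\<close>

text \<open>
  A polynomial is represented with denominator \<open>1\<close>, and any two representations give the same value.
\<close>
lemma ratfun_at_to_fract: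
  fixes h :: "'a::field \<Rightarrow> 'b::field"
  assumes "field_hom h"
  shows "ratfun_at h (to_fract p) x = poly (map_poly h p) x"
proof -
  interpret h: field_hom h by fact
  interpret hp: map_poly_comm_ring_hom h ..
  show ?thesis
    unfolding ratfun_at_def
  proof (rule the_equality)
    show "\<exists>a b. to_fract p = Fraction_Field.Fract a b \<and> poly (map_poly h b) x \<noteq> 0 \<and>
        poly (map_poly h p) x = poly (map_poly h a) x / poly (map_poly h b) x"
      by (intro exI[of _ p] exI[of _ 1]) (simp add: to_fract_def)
  next
    fix v assume "\<exists>a b. to_fract p = Fraction_Field.Fract a b \<and> poly (map_poly h b) x \<noteq> 0 \<and>
        v = poly (map_poly h a) x / poly (map_poly h b) x"
    then obtain a b where ab: "to_fract p = Fraction_Field.Fract a b"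
        "poly (map_poly h b) x \<noteq> 0" "v = poly (map_poly h a) x / poly (map_poly h b) x"
      by blast
    have "b \<noteq> 0" using ab(2) by auto
    then have "a = p * b"
      using ab(1) by (simp add: to_fract_def eq_fract)
    then show "v = poly (map_poly h p) x"
      using ab(2,3) by (simp add: hp.hom_mult)
  qed
qed

lemma field_hom_id: "field_hom (id :: 'a::field \<Rightarrow> 'a)"
  by unfold_locales simp_all

lemma field_hom_ratfun_const: "field_hom (ratfun_const :: 'a::field \<Rightarrow> 'a poly fract)"
  by unfold_locales (simp_all flip: to_fract_add to_fract_mult add: one_pCons)

text \<open>
  For a polynomial \<open>p\<close> of degree at most \<open>g\<close>, multiplying \<open>p(1/x)\<close> by \<open>x ^ g\<close> reverses the list of
  coefficients, so the constant term of the result is the coefficient of \<open>p\<close> at \<open>g\<close>.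
\<close>
lemma eval_rev_mat_at_zero:
  fixes P :: "'a::field poly mat"
  assumes "mat_degree P \<le> g"
  shows "eval_rat_mat (rev_mat (int g) (rat_mat P)) 0 = coeff_mat g P"
proof (rule eq_matI)
  fix i j assume "i < dim_row (coeff_mat g P)" "j < dim_col (coeff_mat g P)"
  then have ij: "i < dim_row P" "j < dim_col P"
    by (auto simp: coeff_mat_def)
  define p where "p = P $$ (i, j)"
  have degp: "degree p \<le> g"
    using assms ij by (simp add: mat_degree_le_iff p_def)
  \<comment> \<open>The reversal of \<open>p\<close> as a polynomial.\<close>
  define r where "r = (\<Sum>k\<le>g. monom (coeff p k) (g - k))"
  let ?x = "ratfun_var :: 'a poly fract"
  have x: "?x \<noteq> 0" by simp
  interpret c: field_hom "ratfun_const :: 'a \<Rightarrow> 'a poly fract"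
    by (rule field_hom_ratfun_const)
  have pow: "?x ^ k = to_fract (monom 1 k)" for k
    by (induction k) (simp_all add: monom_Suc one_pCons[symmetric] monom_0 flip: to_fract_mult)
  have "ratfun_at ratfun_const (to_fract p) (1 / ?x) = poly (map_poly ratfun_const p) (1 / ?x)"
    by (rule ratfun_at_to_fract[OF field_hom_ratfun_const])
  also have "\<dots> = (\<Sum>k\<le>g. ratfun_const (coeff p k) * (1 / ?x) ^ k)"
    unfolding poly_altdef
    using degp map_poly_degree_leq[of ratfun_const p]
    by (intro sum.mono_neutral_cong_left) (auto simp: coeff_map_poly coeff_eq_0)
  finally have "?x powi int g * ratfun_at ratfun_const (to_fract p) (1 / ?x) =
      (\<Sum>k\<le>g. ratfun_const (coeff p k) * (?x ^ g * (1 / ?x) ^ k))"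
    by (simp add: sum_distrib_left mult_ac)
  also have "\<dots> = (\<Sum>k\<le>g. to_fract (monom (coeff p k) (g - k)))"
  proof (intro sum.cong refl)
    fix k assume "k \<in> {..g}"
    then have "?x ^ g * (1 / ?x) ^ k = ?x ^ (g - k)"
      using x by (simp add: power_diff power_one_over field_simps)
    then show "ratfun_const (coeff p k) * (?x ^ g * (1 / ?x) ^ k) = to_fract (monom (coeff p k) (g - k))"
      unfolding pow by (simp flip: to_fract_mult add: smult_monom)
  qed
  also have "\<dots> = to_fract r"
    by (simp add: r_def)
  finally have "eval_rat_mat (rev_mat (int g) (rat_mat P)) 0 $$ (i, j) = ratfun_at id (to_fract r) 0"
    using ij by (simp add: eval_rat_mat_def rev_mat_def p_def)
  also have "\<dots> = poly r 0"
    using ratfun_at_to_fract[of "id :: 'a \<Rightarrow> 'a" r 0]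
    by (simp add: field_hom_id)
  also have "\<dots> = (\<Sum>k\<le>g. if k = g then coeff p g else 0)"
    unfolding r_def poly_sum by (intro sum.cong refl) (auto simp: poly_monom power_0_left)
  also have "\<dots> = coeff_mat g P $$ (i, j)"
    using ij by (simp add: coeff_mat_def p_def)
  finally show "eval_rat_mat (rev_mat (int g) (rat_mat P)) 0 $$ (i, j) = coeff_mat g P $$ (i, j)" .
qed (simp_all add: eval_rat_mat_def rev_mat_def coeff_mat_def)

section \<open>Kernels related by a degree shift\<close>

lemma poly_basis_member:
  assumes sub: "vec_subspace N U" and basis: "poly_basis N U xs" and x: "x \<in> set xs"
  shows "x \<in> carrier_vec N" "rat_vec x \<in> U" "x \<noteq> 0\<^sub>v N"
proof -
  obtain i where i: "i < length xs" "x = xs ! i"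
    using x by (metis in_set_conv_nth)
  note X = poly_basis_iff[OF sub, THEN iffD1, OF basis]
  show carr: "x \<in> carrier_vec N"
    using X x by blast
  have img: "rat_cols N xs *\<^sub>v unit_vec (length xs) i = rat_vec x"
    using i carr mult_unit_vec[OF rat_cols_carrier i(1), of N] by simp
  show "rat_vec x \<in> U"
    using X img by (metis imageI unit_vec_carrier)
  show "x \<noteq> 0\<^sub>v N"
  proof
    assume "x = 0\<^sub>v N"
    then have "rat_cols N xs *\<^sub>v unit_vec (length xs) i = 0\<^sub>v N"
      unfolding img by (simp add: to_fract_hom.vec_hom_zero)
    then have "(unit_vec (length xs) i :: 'a poly fract vec) = 0\<^sub>v (length xs)"
      using X by (intro injective_matD[OF _ rat_cols_carrier]) auto
    then show False using i(1) by simp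
  qed
qed

text \<open>
  \<open>E\<close> maps the kernel of \<open>G\<close> bijectively onto the kernel of \<open>G'\<close>, respects polynomial vectors in both
  directions and raises the degrees of nonzero polynomial vectors by \<open>d\<close>. Families that correspond to
  each other under such a map are minimal bases on both sides or on neither.
\<close>
locale degree_shift =
  fixes G G' E :: "'a::field poly fract mat" and r r' N N' d :: nat
  assumes G: "G \<in> carrier_mat r N" and G': "G' \<in> carrier_mat r' N'"
    and E: "E \<in> carrier_mat N' N"
    and maps: "\<And>w. w \<in> mat_kernel G \<Longrightarrow> E *\<^sub>v w \<in> mat_kernel G'"
    and onto: "\<And>x. x \<in> mat_kernel G' \<Longrightarrow> \<exists>w\<in>mat_kernel G. x = E *\<^sub>v w"
    and inj: "\<And>w. w \<in> mat_kernel G \<Longrightarrow> E *\<^sub>v w = 0\<^sub>v N' \<Longrightarrow> w = 0\<^sub>v N"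
    and poly_preimage: "\<And>w z. w \<in> mat_kernel G \<Longrightarrow> E *\<^sub>v w = rat_vec z \<Longrightarrow> \<exists>u. w = rat_vec u"
    and poly_image: "\<And>u. rat_vec u \<in> mat_kernel G \<Longrightarrow> \<exists>z. E *\<^sub>v rat_vec u = rat_vec z"
    and shift: "\<And>u z. rat_vec u \<in> mat_kernel G \<Longrightarrow> u \<noteq> 0\<^sub>v N \<Longrightarrow>
      E *\<^sub>v rat_vec u = rat_vec z \<Longrightarrow> vec_degree z = vec_degree u + d"
begin

definition related :: "'a poly vec list \<Rightarrow> 'a poly vec list \<Rightarrow> bool" where
  "related us zs \<longleftrightarrow>
     list_all2 (\<lambda>u z. rat_vec u \<in> mat_kernel G \<and> E *\<^sub>v rat_vec u = rat_vec z) us zs"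

lemmas subspaces = vec_subspace_mat_kernel[OF G] vec_subspace_mat_kernel[OF G']

lemma related_length: "related us zs \<Longrightarrow> length zs = length us"
  unfolding related_def by (drule list_all2_lengthD) simp

lemma kernel_carrier: "w \<in> mat_kernel G \<Longrightarrow> w \<in> carrier_vec N"
  using mat_kernelD(1)[OF G] .

lemma inj_on_kernel:
  assumes "w \<in> mat_kernel G" "w' \<in> mat_kernel G" "E *\<^sub>v w = E *\<^sub>v w'"
  shows "w = w'"
proof -
  have w: "w \<in> carrier_vec N" "w' \<in> carrier_vec N"
    using assms kernel_carrier by auto
  have "G *\<^sub>v (w - w') = G *\<^sub>v w - G *\<^sub>v w'"
    using mult_minus_distrib_mat_vec[OF G w] .
  also have "\<dots> = 0\<^sub>v r"
    using assms mat_kernelD[OF G] by auto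
  finally have ker: "w - w' \<in> mat_kernel G"
    using w by (intro mat_kernelI[OF G]) auto
  have "E *\<^sub>v (w - w') = E *\<^sub>v w - E *\<^sub>v w'"
    using mult_minus_distrib_mat_vec[OF E w] .
  also have "\<dots> = 0\<^sub>v N'"
    using assms(3) E by auto
  finally have "w - w' = 0\<^sub>v N"
    using inj[OF ker] by simp
  then show ?thesis
    using w by (auto simp: vec_eq_iff)
qed

text \<open>
  The matrix of the images is \<open>E\<close> times the matrix \<open>X\<close> of the original vectors, and the columns of \<open>X\<close>
  lie in the kernel of \<open>G\<close>, where \<open>E\<close> is injective.
\<close>
lemma related_poly_basis:
  assumes rel: "related us zs"
  shows "poly_basis N (mat_kernel G) us \<longleftrightarrow> poly_basis N' (mat_kernel G') zs"
proof -
  let ?k = "length us"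
  let ?X = "rat_cols N us" and ?Z = "rat_cols N' zs"
  have len: "length zs = ?k"
    using rel by (rule related_length)
  have u: "rat_vec (us ! i) \<in> mat_kernel G" "us ! i \<in> carrier_vec N"
      "E *\<^sub>v rat_vec (us ! i) = rat_vec (zs ! i)" "zs ! i \<in> carrier_vec N'"
    if i: "i < ?k" for i
  proof -
    show 1: "rat_vec (us ! i) \<in> mat_kernel G" "E *\<^sub>v rat_vec (us ! i) = rat_vec (zs ! i)"
      using rel i by (auto simp: related_def list_all2_conv_all_nth)
    then show "us ! i \<in> carrier_vec N"
      using kernel_carrier by force
    show "zs ! i \<in> carrier_vec N'"
      using arg_cong[OF 1(2), of dim_vec] E by (intro carrier_vecI) simp
  qed
  have carr: "set us \<subseteq> carrier_vec N" "set zs \<subseteq> carrier_vec N'"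
    using u len by (auto simp: in_set_conv_nth)
  have Z: "?Z \<in> carrier_mat N' ?k"
    using rat_cols_carrier[of N' zs] len by simp
  have ZX: "?Z = E * ?X"
  proof (rule mat_col_eqI)
    fix i assume "i < dim_col (E * ?X)"
    then have i: "i < ?k" using E by simp
    have "col (E * ?X) i = E *\<^sub>v col ?X i"
      using i by (intro col_mult2[OF E rat_cols_carrier])
    then show "col ?Z i = col (E * ?X) i"
      using u[OF i] i len by simp
  qed (use E len in auto)
  have Zc: "?Z *\<^sub>v c = E *\<^sub>v (?X *\<^sub>v c)" if "c \<in> carrier_vec ?k" for c
    unfolding ZX using assoc_mult_mat_vec[OF E rat_cols_carrier that] .
  have "G * ?X = 0\<^sub>m r ?k"
  proof (rule mat_col_eqI)
    fix i assume "i < dim_col (0\<^sub>m r ?k :: 'a poly fract mat)"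
    then have i: "i < ?k" by simp
    have "col (G * ?X) i = G *\<^sub>v col ?X i"
      using i by (intro col_mult2[OF G rat_cols_carrier])
    then show "col (G * ?X) i = col (0\<^sub>m r ?k) i"
      using u[OF i] i mat_kernelD[OF G] by simp
  qed (use G in auto)
  then have Xker: "?X *\<^sub>v c \<in> mat_kernel G" if "c \<in> carrier_vec ?k" for c
    using that zero_mat_mult_vec[OF that]
      assoc_mult_mat_vec[OF G rat_cols_carrier that]
      mult_mat_vec_carrier[OF rat_cols_carrier that]
    by (intro mat_kernelI[OF G]) auto
  have zero: "E *\<^sub>v 0\<^sub>v N = 0\<^sub>v N'"
    using mult_zero_vec[OF E] .
  have injX: "injective_mat ?X \<longleftrightarrow> injective_mat ?Z"
  proof
    assume X: "injective_mat ?X"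
    show "injective_mat ?Z"
    proof (rule injective_matI[OF Z])
      fix c assume c: "c \<in> carrier_vec ?k" "?Z *\<^sub>v c = 0\<^sub>v N'"
      then have "?X *\<^sub>v c = 0\<^sub>v N"
        using inj[OF Xker[OF c(1)]] Zc by simp
      then show "c = 0\<^sub>v ?k"
        by (intro injective_matD[OF X rat_cols_carrier c(1)])
    qed
  next
    assume Zinj: "injective_mat ?Z"
    show "injective_mat ?X"
    proof (rule injective_matI[OF rat_cols_carrier])
      fix c assume c: "c \<in> carrier_vec ?k" "?X *\<^sub>v c = 0\<^sub>v N"
      then have "?Z *\<^sub>v c = 0\<^sub>v N'"
        using Zc zero by simp
      then show "c = 0\<^sub>v ?k"
        by (intro injective_matD[OF Zinj Z c(1)])
    qed
  qed
  have "(\<lambda>c. ?X *\<^sub>v c) ` carrier_vec ?k = mat_kernel G \<longleftrightarrow>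
      (\<lambda>c. ?Z *\<^sub>v c) ` carrier_vec ?k = mat_kernel G'" (is "?l \<longleftrightarrow> ?r")
  proof
    assume l: ?l
    show ?r
    proof (intro equalityI subsetI)
      fix z assume "z \<in> (\<lambda>c. ?Z *\<^sub>v c) ` carrier_vec ?k"
      then show "z \<in> mat_kernel G'"
        using Zc Xker maps by auto
    next
      fix z assume "z \<in> mat_kernel G'"
      then obtain w where w: "w \<in> mat_kernel G" "z = E *\<^sub>v w"
        using onto by blast
      then obtain c where "c \<in> carrier_vec ?k" "w = ?X *\<^sub>v c"
        using l by blast
      then show "z \<in> (\<lambda>c. ?Z *\<^sub>v c) ` carrier_vec ?k"
        using w Zc by auto
    qed
  next
    assume r: ?r
    show ?l
    proof (intro equalityI subsetI)
      fix w assume "w \<in> (\<lambda>c. ?X *\<^sub>v c) ` carrier_vec ?k"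
      then show "w \<in> mat_kernel G"
        using Xker by auto
    next
      fix w assume w: "w \<in> mat_kernel G"
      then obtain c where c: "c \<in> carrier_vec ?k" "E *\<^sub>v w = ?Z *\<^sub>v c"
        using maps r by blast
      then have "w = ?X *\<^sub>v c"
        using inj_on_kernel[OF w Xker] Zc by simp
      then show "w \<in> (\<lambda>c. ?X *\<^sub>v c) ` carrier_vec ?k"
        using c by blast
    qed
  qed
  then show ?thesis
    unfolding poly_basis_iff[OF subspaces(1)] poly_basis_iff[OF subspaces(2)] len
    using injX carr by simp
qed

lemma poly_basis_lift:
  assumes basis: "poly_basis N' (mat_kernel G') zs"
  obtains us where "related us zs" "poly_basis N (mat_kernel G) us"
proof -
  have "\<exists>u. rat_vec u \<in> mat_kernel G \<and> E *\<^sub>v rat_vec u = rat_vec z" if "z \<in> set zs" for z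
    using poly_basis_member(2)[OF subspaces(2) basis that] onto poly_preimage by metis
  then have "\<exists>us. related us zs"
    unfolding related_def by (induction zs) (auto simp: list_all2_Cons2)
  then show thesis
    using that related_poly_basis basis by blast
qed

lemma poly_basis_push:
  assumes basis: "poly_basis N (mat_kernel G) us"
  obtains zs where "related us zs" "poly_basis N' (mat_kernel G') zs"
proof -
  have "\<exists>z. rat_vec u \<in> mat_kernel G \<and> E *\<^sub>v rat_vec u = rat_vec z" if "u \<in> set us" for u
    using poly_basis_member(2)[OF subspaces(1) basis that] poly_image by metis
  then have "\<exists>zs. related us zs"
    unfolding related_def by (induction us) (auto simp: list_all2_Cons1)
  then show thesis
    using that related_poly_basis basis by blast
qed

lemma related_degrees:
  assumes rel: "related us zs" and basis: "poly_basis N (mat_kernel G) us"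
  shows "map vec_degree zs = map (\<lambda>u. vec_degree u + d) us"
proof (rule nth_equalityI)
  fix i assume "i < length (map vec_degree zs)"
  then have i: "i < length zs" "i < length us"
    using related_length[OF rel] by simp_all
  have "us ! i \<noteq> 0\<^sub>v N"
    using poly_basis_member(3)[OF subspaces(1) basis] i by simp
  then show "map vec_degree zs ! i = map (\<lambda>u. vec_degree u + d) us ! i"
    using rel i shift[of "us ! i" "zs ! i"] by (simp add: related_def list_all2_conv_all_nth)
qed (simp add: related_length[OF rel])

lemma related_degree_sum:
  assumes "related us zs" and "poly_basis N (mat_kernel G) us"
  shows "(\<Sum>z\<leftarrow>zs. vec_degree z) = (\<Sum>u\<leftarrow>us. vec_degree u) + length us * d"
  unfolding related_degrees[OF assms] by (simp add: sum_list_addf sum_list_triv)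

text \<open>
  All bases of a kernel have the same length, so passing to the images raises the degree sum of each
  of them by the same amount; any competitor on one side has a counterpart on the other.
\<close>
lemma related_minimal_basis:
  assumes rel: "related us zs"
  shows "minimal_basis N (mat_kernel G) us \<longleftrightarrow> minimal_basis N' (mat_kernel G') zs"
proof
  assume us: "minimal_basis N (mat_kernel G) us"
  then have b: "poly_basis N (mat_kernel G) us"
    by (simp add: minimal_basis_def)
  show "minimal_basis N' (mat_kernel G') zs"
    unfolding minimal_basis_def
  proof (intro conjI allI impI)
    show "poly_basis N' (mat_kernel G') zs"
      using related_poly_basis[OF rel] b by simp
    fix zs' assume "poly_basis N' (mat_kernel G') zs'"
    then obtain us' where us': "related us' zs'" "poly_basis N (mat_kernel G) us'"
      by (rule poly_basis_lift)
    have "length us' = length us"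
      using poly_basis_length_unique[OF subspaces(1) us'(2) b] .
    moreover have "(\<Sum>u\<leftarrow>us. vec_degree u) \<le> (\<Sum>u\<leftarrow>us'. vec_degree u)"
      using us us' by (simp add: minimal_basis_def)
    ultimately show "(\<Sum>z\<leftarrow>zs. vec_degree z) \<le> (\<Sum>z\<leftarrow>zs'. vec_degree z)"
      using related_degree_sum[OF rel b] related_degree_sum[OF us'] by simp
  qed
next
  assume zs: "minimal_basis N' (mat_kernel G') zs"
  then have b: "poly_basis N (mat_kernel G) us"
    using related_poly_basis[OF rel] by (simp add: minimal_basis_def)
  show "minimal_basis N (mat_kernel G) us"
    unfolding minimal_basis_def
  proof (intro conjI allI impI b)
    fix us' assume us': "poly_basis N (mat_kernel G) us'"
    then obtain zs' where zs': "related us' zs'" "poly_basis N' (mat_kernel G') zs'"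
      by (rule poly_basis_push)
    have "length us' = length us"
      using poly_basis_length_unique[OF subspaces(1) us' b] .
    moreover have "(\<Sum>z\<leftarrow>zs. vec_degree z) \<le> (\<Sum>z\<leftarrow>zs'. vec_degree z)"
      using zs zs' by (simp add: minimal_basis_def)
    ultimately show "(\<Sum>u\<leftarrow>us. vec_degree u) \<le> (\<Sum>u\<leftarrow>us'. vec_degree u)"
      using related_degree_sum[OF rel b] related_degree_sum[OF zs'(1) us'] by simp
  qed
qed

end

section \<open>Kernels of system matrices\<close>

lemma transfer_function_carrier:
  assumes "A \<in> carrier_mat n n" "D \<in> carrier_mat p m"
    and "B \<in> carrier_mat n m" "C \<in> carrier_mat p n"
  shows "transfer_function A B C D \<in> carrier_mat p m"
  using assms by (auto simp: transfer_function_def)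

lemma mat_kernel_system_matrix:
  fixes A B C D :: "'a::field poly mat"
  assumes A: "A \<in> carrier_mat n n" and B: "B \<in> carrier_mat n m"
    and C: "C \<in> carrier_mat p n" and D: "D \<in> carrier_mat p m"
    and y: "y \<in> carrier_vec n" and x: "x \<in> carrier_vec m"
  shows "y @\<^sub>v x \<in> mat_kernel (rat_mat (system_matrix A B C D)) \<longleftrightarrow>
    rat_mat A *\<^sub>v y + rat_mat B *\<^sub>v x = 0\<^sub>v n \<and> rat_mat D *\<^sub>v x = rat_mat C *\<^sub>v y"
proof -
  let ?S = "rat_mat (system_matrix A B C D)"
  have S: "?S = four_block_mat (rat_mat A) (rat_mat B) (- rat_mat C) (rat_mat D)"
    using A B C D by (intro eq_matI) (auto simp: system_matrix_def)
  have Sc: "?S \<in> carrier_mat (n + p) (n + m)"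
    using A D by (simp add: system_matrix_def)
  have "?S *\<^sub>v (y @\<^sub>v x) =
      (rat_mat A *\<^sub>v y + rat_mat B *\<^sub>v x) @\<^sub>v (- rat_mat C *\<^sub>v y + rat_mat D *\<^sub>v x)"
    unfolding S by (rule four_block_mat_mult_vec) (use A B C D y x in auto)
  moreover have "0\<^sub>v (n + p) = 0\<^sub>v n @\<^sub>v (0\<^sub>v p :: 'a poly fract vec)"
    by (intro eq_vecI) auto
  moreover have "rat_mat A *\<^sub>v y + rat_mat B *\<^sub>v x \<in> carrier_vec n"
    using A B by (intro add_carrier_vec mult_mat_vec_carrier) (use x y in auto)
  ultimately have "?S *\<^sub>v (y @\<^sub>v x) = 0\<^sub>v (n + p) \<longleftrightarrow>
      rat_mat A *\<^sub>v y + rat_mat B *\<^sub>v x = 0\<^sub>v n \<and> - rat_mat C *\<^sub>v y + rat_mat D *\<^sub>v x = 0\<^sub>v p"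
    by (simp add: append_vec_eq[of _ n])
  also have "- rat_mat C *\<^sub>v y + rat_mat D *\<^sub>v x = 0\<^sub>v p \<longleftrightarrow> rat_mat D *\<^sub>v x = rat_mat C *\<^sub>v y"
  proof -
    have "- rat_mat C *\<^sub>v y = - (rat_mat C *\<^sub>v y)"
      using C y by (intro uminus_mult_mat_vec) auto
    moreover have "- c + e = 0\<^sub>v p \<longleftrightarrow> e = c" if "c \<in> carrier_vec p" "e \<in> carrier_vec p"
      for c e :: "'a poly fract vec"
      using that by (auto simp: vec_eq_iff)
    moreover have "rat_mat C *\<^sub>v y \<in> carrier_vec p" "rat_mat D *\<^sub>v x \<in> carrier_vec p"
      using C D y x by (auto intro!: mult_mat_vec_carrier)
    ultimately show ?thesis by metis
  qed
  finally show ?thesis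
    using mat_kernel[OF Sc] x y by simp
qed

text \<open>
  Block elimination: the first block row determines \<open>y\<close> from \<open>x\<close>, and substituting it in the second
  block row gives the transfer function.
\<close>
lemma system_kernel_iff_transfer_kernel:
  fixes A B C D :: "'a::field poly mat"
  assumes A: "A \<in> carrier_mat n n" and B: "B \<in> carrier_mat n m"
    and C: "C \<in> carrier_mat p n" and D: "D \<in> carrier_mat p m"
    and inj: "injective_mat (rat_mat A)"
    and y: "y \<in> carrier_vec n" and x: "x \<in> carrier_vec m"
  shows "y @\<^sub>v x \<in> mat_kernel (rat_mat (system_matrix A B C D)) \<longleftrightarrow>
    x \<in> mat_kernel (transfer_function A B C D) \<and>
    y = - (the (mat_inverse (rat_mat A)) *\<^sub>v (rat_mat B *\<^sub>v x))"
proof -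
  have rA: "rat_mat A \<in> carrier_mat n n" and rB: "rat_mat B \<in> carrier_mat n m"
    and rC: "rat_mat C \<in> carrier_mat p n" and rD: "rat_mat D \<in> carrier_mat p m"
    using A B C D by auto
  define I where "I = the (mat_inverse (rat_mat A))"
  note I = mat_inverse_injective(2,3,1)[OF rA inj, folded I_def]
  let ?b = "rat_mat B *\<^sub>v x"
  have b: "?b \<in> carrier_vec n"
    using rB x by (rule mult_mat_vec_carrier)
  have Ib: "I *\<^sub>v ?b \<in> carrier_vec n"
    using I(3) b by (rule mult_mat_vec_carrier)
  have Ay: "rat_mat A *\<^sub>v y \<in> carrier_vec n"
    using rA y by (rule mult_mat_vec_carrier)
  have solve: "rat_mat A *\<^sub>v y + ?b = 0\<^sub>v n \<longleftrightarrow> y = - (I *\<^sub>v ?b)"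
  proof
    assume "rat_mat A *\<^sub>v y + ?b = 0\<^sub>v n"
    then have "rat_mat A *\<^sub>v y = - ?b"
      using add_eq_zero_vec_iff[OF Ay b] by simp
    then have "I *\<^sub>v (rat_mat A *\<^sub>v y) = - (I *\<^sub>v ?b)"
      using mult_mat_uminus_vec[OF I(3) b] by simp
    then show "y = - (I *\<^sub>v ?b)"
      using assoc_mult_mat_vec[OF I(3) rA y] I(2) y by simp
  next
    assume "y = - (I *\<^sub>v ?b)"
    then have "rat_mat A *\<^sub>v y = - (rat_mat A *\<^sub>v (I *\<^sub>v ?b))"
      using mult_mat_uminus_vec[OF rA Ib] by simp
    also have "rat_mat A *\<^sub>v (I *\<^sub>v ?b) = ?b"
      using assoc_mult_mat_vec[OF rA I(3) b] I(1) b by simp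
    finally show "rat_mat A *\<^sub>v y + ?b = 0\<^sub>v n"
      using b by simp
  qed
  have T: "transfer_function A B C D \<in> carrier_mat p m"
    by (rule transfer_function_carrier[OF A D B C])
  have "transfer_function A B C D *\<^sub>v x = rat_mat D *\<^sub>v x + rat_mat C *\<^sub>v (I *\<^sub>v ?b)"
  proof -
    have CI: "rat_mat C * I \<in> carrier_mat p n"
      using rC I(3) by auto
    have "transfer_function A B C D *\<^sub>v x = rat_mat D *\<^sub>v x + rat_mat C * I * rat_mat B *\<^sub>v x"
      unfolding transfer_function_def I_def[symmetric]
      using rD CI rB x by (intro add_mult_distrib_mat_vec) auto
    also have "rat_mat C * I * rat_mat B *\<^sub>v x = rat_mat C *\<^sub>v (I *\<^sub>v ?b)"
      using assoc_mult_mat_vec[OF CI rB x] assoc_mult_mat_vec[OF rC I(3) b] by simp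
    finally show ?thesis .
  qed
  moreover have "rat_mat D *\<^sub>v x \<in> carrier_vec p" "rat_mat C *\<^sub>v (I *\<^sub>v ?b) \<in> carrier_vec p"
    using rD x rC Ib by (auto intro: mult_mat_vec_carrier)
  ultimately have "x \<in> mat_kernel (transfer_function A B C D) \<longleftrightarrow>
      rat_mat D *\<^sub>v x = - (rat_mat C *\<^sub>v (I *\<^sub>v ?b))"
    using mat_kernel[OF T] x add_eq_zero_vec_iff by auto
  also have "\<dots> \<longleftrightarrow> rat_mat D *\<^sub>v x = rat_mat C *\<^sub>v (- (I *\<^sub>v ?b))"
    using mult_mat_uminus_vec[OF rC Ib] by simp
  finally show ?thesis
    unfolding mat_kernel_system_matrix[OF A B C D y x] solve I_def[symmetric] by auto
qed

section \<open>Strong block minimal basis pencils\<close>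

text \<open>
  A strong block minimal basis pencil together with a chosen dual basis; it is associated with the
  polynomial matrix \<open>M * N\<^sup>T\<close>.
\<close>
locale minimal_basis_pencil =
  fixes M K N :: "'a::alg_closed_field poly mat" and r c \<rho> :: nat
  assumes M: "M \<in> carrier_mat r ((\<rho> + 1) * c)" and K: "K \<in> carrier_mat (\<rho> * c) ((\<rho> + 1) * c)"
    and N: "N \<in> carrier_mat c ((\<rho> + 1) * c)"
    and pencil: "strong_block_minimal_basis_pencil M K"
    and dual: "dual_minimal_bases K N" and equal_degrees: "equal_row_degrees N"
    and degree: "\<rho> = mat_degree N"
begin

lemma min_K: "minimal_basis_mat K" and min_N: "minimal_basis_mat N"
  and KNT: "K * N\<^sup>T = 0\<^sub>m (\<rho> * c) c"
  using dual K N by (auto simp: dual_minimal_bases_def)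

lemma NT: "N\<^sup>T \<in> carrier_mat ((\<rho> + 1) * c) c"
  using N by simp

text \<open>
  A minimal basis has fewer rows than columns, which excludes \<open>\<rho> = 0\<close>. The reduction of row degrees
  in the exchange argument relies on this.
\<close>
lemma degree_pos: "0 < \<rho>"
proof -
  have "dim_row N < dim_col N"
    using min_N by (simp add: minimal_basis_mat_def)
  then have "c < (\<rho> + 1) * c"
    using N by simp
  then show ?thesis by (cases \<rho>) auto
qed

lemma row_degrees: "i < c \<Longrightarrow> row_degree N i = \<rho>"
proof (rule antisym)
  assume i: "i < c"
  show "row_degree N i \<le> \<rho>"
    using i N mat_degree_le_iff[of N \<rho>] degree by (auto simp: vec_degree_le_iff)
  have "degree (N $$ (j, k)) \<le> row_degree N i" if "j < c" "k < (\<rho> + 1) * c" for j k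
  proof -
    have "degree (row N j $ k) \<le> row_degree N j"
      using that N by (intro degree_le_vec_degree) simp
    also have "row_degree N j = row_degree N i"
      using equal_degrees that i N unfolding equal_row_degrees_def by blast
    finally show ?thesis using that N by simp
  qed
  then have "mat_degree N \<le> row_degree N i"
    unfolding mat_degree_le_iff using N by auto
  then show "\<rho> \<le> row_degree N i"
    using degree by simp
qed

lemma degree_NT: "mat_degree N\<^sup>T \<le> \<rho>"
  using degree by simp

lemma leading_coeff_NT: "injective_mat (coeff_mat \<rho> N\<^sup>T)"
  using minimal_basis_leading_coeff_injective[OF N min_N _ row_degrees degree_pos] degree by simp

lemma eval_NT: "injective_mat (eval_mat N\<^sup>T z)"
  using minimal_basis_eval_injective[OF N min_N _ row_degrees degree_pos] degree by simp

lemma linear_M: "mat_degree M \<le> 1"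
  using pencil mat_degree_append_rows[OF M K]
  by (simp add: strong_block_minimal_basis_pencil_def linear_mat_iff_mat_degree)

lemma degree_mult_NT:
  assumes Q: "Q \<in> carrier_mat q ((\<rho> + 1) * c)" "mat_degree Q \<le> 1"
  shows "mat_degree (Q * N\<^sup>T) \<le> \<rho> + 1"
  unfolding mat_degree_le_iff
proof (intro allI impI)
  fix i j assume ij: "i < dim_row (Q * N\<^sup>T)" "j < dim_col (Q * N\<^sup>T)"
  have "vec_degree (col N\<^sup>T j) \<le> \<rho>"
    using row_degrees[of j] ij N by simp
  then have "vec_degree (Q *\<^sub>v col N\<^sup>T j) \<le> 1 + \<rho>"
    using N by (intro vec_degree_mult_le[OF Q(1) _ Q(2)] carrier_vecI) simp_all
  then show "degree ((Q * N\<^sup>T) $$ (i, j)) \<le> \<rho> + 1"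
    using ij by (auto simp: vec_degree_le_iff)
qed

lemma injective_NT: "injective_mat (rat_mat N\<^sup>T)"
  by (rule minimal_basis_mat_injective[OF N min_N])

lemma K_NT_mult:
  assumes "v \<in> carrier_vec c"
  shows "rat_mat K *\<^sub>v (rat_mat N\<^sup>T *\<^sub>v v) = 0\<^sub>v (\<rho> * c)"
proof -
  have "rat_mat (K * N\<^sup>T) = 0\<^sub>m (\<rho> * c) c"
    unfolding KNT by (intro eq_matI) auto
  then show ?thesis
    using rat_mat_mult_assoc[OF K NT assms] zero_mat_mult_vec[OF assms] by simp
qed

lemma kernel_K:
  assumes "y \<in> carrier_vec ((\<rho> + 1) * c)" "rat_mat K *\<^sub>v y = 0\<^sub>v (\<rho> * c)"
  obtains v where "v \<in> carrier_vec c" "y = rat_mat N\<^sup>T *\<^sub>v v"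
proof (rule kernel_eq_range_of_complement[of "rat_mat K" "\<rho> * c" "(\<rho> + 1) * c" "rat_mat N\<^sup>T" c y])
  have "(rat_mat K)\<^sup>T = rat_mat K\<^sup>T"
    by (intro eq_matI) auto
  then show "injective_mat (rat_mat K)\<^sup>T"
    using minimal_basis_mat_injective[OF K min_K] by simp
  show "rat_mat K * rat_mat N\<^sup>T = 0\<^sub>m (\<rho> * c) c"
    unfolding to_fract_hom.mat_hom_mult[OF K NT, symmetric] KNT by (intro eq_matI) auto
qed (use assms K NT injective_NT that in auto)

lemma degree_NT_mult:
  "u \<in> carrier_vec c \<Longrightarrow> u \<noteq> 0\<^sub>v c \<Longrightarrow> vec_degree (N\<^sup>T *\<^sub>v u) = \<rho> + vec_degree u"
  using vec_degree_mult_eq[OF NT degree_NT leading_coeff_NT] .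

lemma polynomial_NT_preimage:
  assumes "u \<in> carrier_vec c" "rat_mat N\<^sup>T *\<^sub>v u = rat_vec x"
  obtains v where "v \<in> carrier_vec c" "u = rat_vec v"
  using polynomial_of_polynomial_image[OF NT eval_NT assms] .

end

section \<open>Linearized system matrices\<close>

text \<open>
  The two rank hypotheses of the theorem appear here in the form in which they are used. The matrices
  of the system are products with the dual bases and are abbreviated by \<open>sysA\<close> to \<open>sysD\<close>; the
  blocks of the linear system matrix \<open>L\<close> are \<open>linA\<close> to \<open>linD\<close>.
\<close>
locale linearized_system =
  A: minimal_basis_pencil M\<^sub>A K\<^sub>A N\<^sub>A n n \<rho>\<^sub>A + D: minimal_basis_pencil M\<^sub>D K\<^sub>D N\<^sub>D p m \<rho>\<^sub>D
  for M\<^sub>A K\<^sub>A N\<^sub>A M\<^sub>D K\<^sub>D N\<^sub>D :: "'a::alg_closed_field poly mat" and n m p \<rho>\<^sub>A \<rho>\<^sub>D :: nat +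
  fixes M\<^sub>B M\<^sub>C :: "'a poly mat"
  assumes M\<^sub>B: "M\<^sub>B \<in> carrier_mat n ((\<rho>\<^sub>D + 1) * m)" "linear_mat M\<^sub>B"
    and M\<^sub>C: "M\<^sub>C \<in> carrier_mat p ((\<rho>\<^sub>A + 1) * n)" "linear_mat M\<^sub>C"
    and regular: "det (M\<^sub>A * N\<^sub>A\<^sup>T) \<noteq> 0"
    and values_injective: "\<And>z. injective_mat (eval_mat (M\<^sub>A * N\<^sub>A\<^sup>T @\<^sub>r M\<^sub>C * N\<^sub>A\<^sup>T) z)"
    and leading_injective: "injective_mat (coeff_mat (\<rho>\<^sub>A + 1) (M\<^sub>A * N\<^sub>A\<^sup>T @\<^sub>r M\<^sub>C * N\<^sub>A\<^sup>T))"
begin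

abbreviation "sysA \<equiv> M\<^sub>A * N\<^sub>A\<^sup>T"
abbreviation "sysB \<equiv> M\<^sub>B * N\<^sub>D\<^sup>T"
abbreviation "sysC \<equiv> M\<^sub>C * N\<^sub>A\<^sup>T"
abbreviation "sysD \<equiv> M\<^sub>D * N\<^sub>D\<^sup>T"
abbreviation "linA \<equiv> M\<^sub>A @\<^sub>r K\<^sub>A"
abbreviation "linB \<equiv> M\<^sub>B @\<^sub>r 0\<^sub>m (\<rho>\<^sub>A * n) ((\<rho>\<^sub>D + 1) * m)"
abbreviation "linC \<equiv> M\<^sub>C @\<^sub>r 0\<^sub>m (\<rho>\<^sub>D * m) ((\<rho>\<^sub>A + 1) * n)"
abbreviation "linD \<equiv> M\<^sub>D @\<^sub>r K\<^sub>D"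
abbreviation "NA \<equiv> (\<rho>\<^sub>A + 1) * n"
abbreviation "ND \<equiv> (\<rho>\<^sub>D + 1) * m"
abbreviation "R \<equiv> transfer_function sysA sysB sysC sysD"
abbreviation "R' \<equiv> transfer_function linA linB linC linD"
abbreviation "L \<equiv> system_matrix linA linB linC linD"

lemma system_carriers:
  "sysA \<in> carrier_mat n n" "sysB \<in> carrier_mat n m" "sysC \<in> carrier_mat p n" "sysD \<in> carrier_mat p m"
  using A.M A.NT D.M D.NT M\<^sub>B(1) M\<^sub>C(1) by auto

lemma pencil_carriers:
  "linA \<in> carrier_mat NA NA" "linB \<in> carrier_mat NA ND"
  "linC \<in> carrier_mat (p + \<rho>\<^sub>D * m) NA" "linD \<in> carrier_mat (p + \<rho>\<^sub>D * m) ND"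
proof -
  have NA: "n + \<rho>\<^sub>A * n = NA" by simp
  show "linA \<in> carrier_mat NA NA" "linB \<in> carrier_mat NA ND"
    using carrier_append_rows[OF A.M A.K] carrier_append_rows[OF M\<^sub>B(1), of "0\<^sub>m (\<rho>\<^sub>A * n) ND"]
    unfolding NA by auto
  show "linC \<in> carrier_mat (p + \<rho>\<^sub>D * m) NA" "linD \<in> carrier_mat (p + \<rho>\<^sub>D * m) ND"
    using carrier_append_rows[OF D.M D.K] carrier_append_rows[OF M\<^sub>C(1), of "0\<^sub>m (\<rho>\<^sub>D * m) NA"]
    by auto
qed

lemmas rat_system_carriers = system_carriers[THEN map_carrier_mat[THEN iffD2]]
lemmas rat_pencil_carriers = pencil_carriers[THEN map_carrier_mat[THEN iffD2]]

lemma R_carrier: "R \<in> carrier_mat p m"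
  using system_carriers by (intro transfer_function_carrier)

lemma R'_carrier: "R' \<in> carrier_mat (p + \<rho>\<^sub>D * m) ND"
  using pencil_carriers by (intro transfer_function_carrier)

lemma L_carrier: "rat_mat L \<in> carrier_mat (NA + (p + \<rho>\<^sub>D * m)) (NA + ND)"
  using four_block_carrier_mat[OF pencil_carriers(1,4)] by (simp add: system_matrix_def)

lemma injective_sysA: "injective_mat (rat_mat sysA)"
proof -
  note rA = rat_system_carriers(1)
  have "det (rat_mat sysA) \<noteq> 0"
    using regular by (simp add: to_fract_hom.hom_det)
  then show ?thesis
    using det_0_iff_vec_prod_zero_field[OF rA] by (intro injective_matI[OF rA]) blast
qed

text \<open>
  The state matrix of the pencil is regular: \<open>K\<^sub>A y = 0\<close> gives \<open>y = N\<^sub>A\<^sup>T v\<close>, and then \<open>M\<^sub>A y = 0\<close> says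
  that \<open>v\<close> is in the kernel of the regular matrix \<open>M\<^sub>A * N\<^sub>A\<^sup>T\<close>.
\<close>
lemma injective_linA: "injective_mat (rat_mat linA)"
proof (rule injective_matI)
  show "rat_mat linA \<in> carrier_mat NA NA"
    using pencil_carriers(1) by simp
  fix y assume y: "y \<in> carrier_vec NA" "rat_mat linA *\<^sub>v y = 0\<^sub>v NA"
  have "rat_mat M\<^sub>A *\<^sub>v y = 0\<^sub>v n \<and> rat_mat K\<^sub>A *\<^sub>v y = 0\<^sub>v (\<rho>\<^sub>A * n)"
    using append_rows_kernel[of "rat_mat M\<^sub>A" n NA "rat_mat K\<^sub>A" "\<rho>\<^sub>A * n" y] y A.M A.K
      rat_mat_append_rows[OF A.M A.K] by simp
  moreover from this obtain v where v: "v \<in> carrier_vec n" "y = rat_mat N\<^sub>A\<^sup>T *\<^sub>v v"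
    using A.kernel_K[OF y(1)] by blast
  ultimately have "rat_mat sysA *\<^sub>v v = 0\<^sub>v n"
    using rat_mat_mult_assoc[OF A.M A.NT v(1)] by simp
  then have "v = 0\<^sub>v n"
    by (rule injective_matD[OF injective_sysA rat_system_carriers(1) v(1)])
  then show "y = 0\<^sub>v NA"
    unfolding v(2) using mult_zero_vec[of "rat_mat N\<^sub>A\<^sup>T" NA n] A.NT by simp
qed

lemma mat_kernel_L:
  assumes y: "y \<in> carrier_vec NA" and x: "x \<in> carrier_vec ND"
  shows "y @\<^sub>v x \<in> mat_kernel (rat_mat L) \<longleftrightarrow>
    rat_mat M\<^sub>A *\<^sub>v y + rat_mat M\<^sub>B *\<^sub>v x = 0\<^sub>v n \<and> rat_mat K\<^sub>A *\<^sub>v y = 0\<^sub>v (\<rho>\<^sub>A * n) \<and>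
    rat_mat M\<^sub>D *\<^sub>v x = rat_mat M\<^sub>C *\<^sub>v y \<and> rat_mat K\<^sub>D *\<^sub>v x = 0\<^sub>v (\<rho>\<^sub>D * m)"
proof -
  have mult: "rat_mat (P @\<^sub>r Q) *\<^sub>v w = (rat_mat P *\<^sub>v w) @\<^sub>v (rat_mat Q *\<^sub>v w)"
    if "P \<in> carrier_mat r1 k" "Q \<in> carrier_mat r2 k" "w \<in> carrier_vec k"
    for P Q :: "'a poly mat" and w r1 r2 k
    unfolding rat_mat_append_rows[OF that(1,2)] using that by (intro mat_mult_append) auto
  have zero: "rat_mat (0\<^sub>m r1 k) *\<^sub>v w = 0\<^sub>v r1" if "w \<in> carrier_vec k" for w :: "'a poly fract vec" and r1 k
  proof -
    have "rat_mat (0\<^sub>m r1 k :: 'a poly mat) = 0\<^sub>m r1 k"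
      by (intro eq_matI) auto
    then show ?thesis using zero_mat_mult_vec[OF that] by simp
  qed
  have add: "(a @\<^sub>v b) + (a' @\<^sub>v b') = (a + a') @\<^sub>v (b + b')"
    if "a \<in> carrier_vec k" "a' \<in> carrier_vec k" "b \<in> carrier_vec l" "b' \<in> carrier_vec l"
    for a a' b b' :: "'a poly fract vec" and k l
    using that by (intro eq_vecI) auto
  have My: "rat_mat M\<^sub>A *\<^sub>v y \<in> carrier_vec n" "rat_mat M\<^sub>B *\<^sub>v x \<in> carrier_vec n"
      "rat_mat K\<^sub>A *\<^sub>v y \<in> carrier_vec (\<rho>\<^sub>A * n)"
      "rat_mat M\<^sub>D *\<^sub>v x \<in> carrier_vec p" "rat_mat M\<^sub>C *\<^sub>v y \<in> carrier_vec p"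
    using A.M A.K M\<^sub>B(1) M\<^sub>C(1) D.M x y by (auto intro!: mult_mat_vec_carrier)
  have zeroNA: "0\<^sub>v NA = 0\<^sub>v n @\<^sub>v (0\<^sub>v (\<rho>\<^sub>A * n) :: 'a poly fract vec)"
    by (intro eq_vecI) auto
  have "rat_mat linA *\<^sub>v y + rat_mat linB *\<^sub>v x = 0\<^sub>v NA \<longleftrightarrow>
      rat_mat M\<^sub>A *\<^sub>v y + rat_mat M\<^sub>B *\<^sub>v x = 0\<^sub>v n \<and> rat_mat K\<^sub>A *\<^sub>v y = 0\<^sub>v (\<rho>\<^sub>A * n)"
    unfolding mult[OF A.M A.K y] mult[OF M\<^sub>B(1) zero_carrier_mat x] zero[OF x] zeroNA
    using My by (subst add[of _ n _ _ "\<rho>\<^sub>A * n"]) (auto simp: append_vec_eq[of _ n])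
  moreover have "rat_mat linD *\<^sub>v x = rat_mat linC *\<^sub>v y \<longleftrightarrow>
      rat_mat M\<^sub>D *\<^sub>v x = rat_mat M\<^sub>C *\<^sub>v y \<and> rat_mat K\<^sub>D *\<^sub>v x = 0\<^sub>v (\<rho>\<^sub>D * m)"
    unfolding mult[OF D.M D.K x] mult[OF M\<^sub>C(1) zero_carrier_mat y] zero[OF y]
    by (rule append_vec_eq[OF My(4,5)])
  ultimately show ?thesis
    unfolding mat_kernel_system_matrix[OF pencil_carriers y x] by blast
qed

lemma mat_kernel_L_lift:
  assumes v: "v \<in> carrier_vec n" and u: "u \<in> carrier_vec m"
  shows "(rat_mat N\<^sub>A\<^sup>T *\<^sub>v v) @\<^sub>v (rat_mat N\<^sub>D\<^sup>T *\<^sub>v u) \<in> mat_kernel (rat_mat L) \<longleftrightarrow>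
    v @\<^sub>v u \<in> mat_kernel (rat_mat (system_matrix sysA sysB sysC sysD))"
proof -
  have carr: "rat_mat N\<^sub>A\<^sup>T *\<^sub>v v \<in> carrier_vec NA" "rat_mat N\<^sub>D\<^sup>T *\<^sub>v u \<in> carrier_vec ND"
    using A.NT D.NT u v by (auto intro!: mult_mat_vec_carrier)
  show ?thesis
    unfolding mat_kernel_L[OF carr] mat_kernel_system_matrix[OF system_carriers v u]
    unfolding A.K_NT_mult[OF v] D.K_NT_mult[OF u]
      rat_mat_mult_assoc[OF A.M A.NT v] rat_mat_mult_assoc[OF M\<^sub>C(1) A.NT v]
      rat_mat_mult_assoc[OF D.M D.NT u] rat_mat_mult_assoc[OF M\<^sub>B(1) D.NT u]
    by simp
qed

text \<open>
  The rows with \<open>K\<^sub>A\<close> and \<open>K\<^sub>D\<close> act on one component each, so duality applies to both components.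
\<close>
lemma mat_kernel_L_cases:
  assumes z: "z \<in> mat_kernel (rat_mat L)"
  obtains v u where "v \<in> carrier_vec n" "u \<in> carrier_vec m"
    "z = (rat_mat N\<^sub>A\<^sup>T *\<^sub>v v) @\<^sub>v (rat_mat N\<^sub>D\<^sup>T *\<^sub>v u)"
proof -
  have "z \<in> carrier_vec (NA + ND)"
    using mat_kernelD(1)[OF L_carrier z] .
  then obtain y x where yx: "y \<in> carrier_vec NA" "x \<in> carrier_vec ND" "z = y @\<^sub>v x"
    by (metis vec_first_last_append vec_first_carrier vec_last_carrier)
  have ker: "rat_mat K\<^sub>A *\<^sub>v y = 0\<^sub>v (\<rho>\<^sub>A * n)" "rat_mat K\<^sub>D *\<^sub>v x = 0\<^sub>v (\<rho>\<^sub>D * m)"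
    using z mat_kernel_L[OF yx(1,2)] unfolding yx(3) by auto
  show thesis
    using A.kernel_K[OF yx(1) ker(1)] D.kernel_K[OF yx(2) ker(2)] that yx(3) by metis
qed

text \<open>
  The only \<open>v\<close> for which \<open>(v, u)\<close> can lie in the kernel of the system matrix of \<open>R\<close>.
\<close>
definition state :: "'a poly fract vec \<Rightarrow> 'a poly fract vec" where
  "state u = - (the (mat_inverse (rat_mat sysA)) *\<^sub>v (rat_mat sysB *\<^sub>v u))"

lemma sysA_inverse_carrier: "the (mat_inverse (rat_mat sysA)) \<in> carrier_mat n n"
  by (rule mat_inverse_injective(1)[OF rat_system_carriers(1) injective_sysA])

lemma state_carrier: "u \<in> carrier_vec m \<Longrightarrow> state u \<in> carrier_vec n"
  unfolding state_def uminus_carrier_vec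
  by (intro mult_mat_vec_carrier[OF sysA_inverse_carrier] mult_mat_vec_carrier[OF rat_system_carriers(2)])

lemma system_kernel_iff:
  assumes "v \<in> carrier_vec n" "u \<in> carrier_vec m"
  shows "v @\<^sub>v u \<in> mat_kernel (rat_mat (system_matrix sysA sysB sysC sysD)) \<longleftrightarrow>
    u \<in> mat_kernel R \<and> v = state u"
  unfolding state_def
  by (rule system_kernel_iff_transfer_kernel[OF system_carriers injective_sysA assms])

text \<open>
  The matrix of \<open>u \<mapsto> (N\<^sub>A\<^sup>T v, N\<^sub>D\<^sup>T u)\<close>, where \<open>v\<close> is the state of \<open>u\<close>.
\<close>
definition embed :: "'a poly fract mat" where
  "embed = (- (rat_mat N\<^sub>A\<^sup>T * (the (mat_inverse (rat_mat sysA)) * rat_mat sysB))) @\<^sub>r rat_mat N\<^sub>D\<^sup>T"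

lemma embed_blocks:
  "- (rat_mat N\<^sub>A\<^sup>T * (the (mat_inverse (rat_mat sysA)) * rat_mat sysB)) \<in> carrier_mat NA m"
  "rat_mat N\<^sub>D\<^sup>T \<in> carrier_mat ND m"
proof -
  have TA: "rat_mat N\<^sub>A\<^sup>T \<in> carrier_mat NA n"
    using A.NT by simp
  show "- (rat_mat N\<^sub>A\<^sup>T * (the (mat_inverse (rat_mat sysA)) * rat_mat sysB)) \<in> carrier_mat NA m"
    using mult_carrier_mat[OF TA mult_carrier_mat[OF sysA_inverse_carrier rat_system_carriers(2)]]
    by (rule uminus_carrier_mat)
  show "rat_mat N\<^sub>D\<^sup>T \<in> carrier_mat ND m"
    using D.NT by simp
qed

lemma embed_carrier: "embed \<in> carrier_mat (NA + ND) m"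
  unfolding embed_def by (rule carrier_append_rows[OF embed_blocks])

lemma embed_mult:
  assumes u: "u \<in> carrier_vec m"
  shows "embed *\<^sub>v u = (rat_mat N\<^sub>A\<^sup>T *\<^sub>v state u) @\<^sub>v (rat_mat N\<^sub>D\<^sup>T *\<^sub>v u)"
proof -
  let ?I = "the (mat_inverse (rat_mat sysA))"
  note rB = rat_system_carriers(2)
  have TA: "rat_mat N\<^sub>A\<^sup>T \<in> carrier_mat NA n"
    using A.NT by simp
  have IB: "?I * rat_mat sysB \<in> carrier_mat n m"
    using mult_carrier_mat[OF sysA_inverse_carrier rB] .
  have "- (rat_mat N\<^sub>A\<^sup>T * (?I * rat_mat sysB)) *\<^sub>v u = - (rat_mat N\<^sub>A\<^sup>T * (?I * rat_mat sysB) *\<^sub>v u)"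
    by (rule uminus_mult_mat_vec[OF mult_carrier_mat[OF TA IB] u])
  also have "rat_mat N\<^sub>A\<^sup>T * (?I * rat_mat sysB) *\<^sub>v u = rat_mat N\<^sub>A\<^sup>T *\<^sub>v (?I *\<^sub>v (rat_mat sysB *\<^sub>v u))"
    using assoc_mult_mat_vec[OF TA IB u] assoc_mult_mat_vec[OF sysA_inverse_carrier rB u] by simp
  also have "- (rat_mat N\<^sub>A\<^sup>T *\<^sub>v (?I *\<^sub>v (rat_mat sysB *\<^sub>v u))) = rat_mat N\<^sub>A\<^sup>T *\<^sub>v state u"
  proof -
    have "?I *\<^sub>v (rat_mat sysB *\<^sub>v u) \<in> carrier_vec n"
      using mult_mat_vec_carrier[OF sysA_inverse_carrier mult_mat_vec_carrier[OF rB u]] .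
    then show ?thesis
      unfolding state_def by (rule mult_mat_uminus_vec[OF TA, symmetric])
  qed
  finally show ?thesis
    unfolding embed_def mat_mult_append[OF embed_blocks u] by simp
qed

text \<open>
  This is where both rank hypotheses enter. The state \<open>v\<close> solves \<open>P v = b\<close> with \<open>P\<close> the matrix \<open>sysA\<close>
  on top of \<open>sysC\<close> and \<open>b\<close> the polynomial vector with blocks \<open>- M\<^sub>B x\<close> and \<open>M\<^sub>D x\<close>,
  where \<open>x = N\<^sub>D\<^sup>T u\<close>. Injective values of \<open>P\<close> make \<open>v\<close> polynomial; the injective coefficient matrix at degree \<open>\<rho>\<^sub>A + 1\<close> makes the degree of \<open>b\<close>
  equal to \<open>\<rho>\<^sub>A + 1 + deg v\<close>, whereas linearity of \<open>M\<^sub>B\<close> and \<open>M\<^sub>D\<close> bounds it by \<open>1 + deg x\<close>.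
\<close>
lemma polynomial_state:
  assumes ker: "rat_vec u \<in> mat_kernel R"
  obtains v where "v \<in> carrier_vec n" "state (rat_vec u) = rat_vec v"
    "\<rho>\<^sub>A + vec_degree v \<le> vec_degree (N\<^sub>D\<^sup>T *\<^sub>v u) \<or> v = 0\<^sub>v n"
proof -
  let ?P = "sysA @\<^sub>r sysC"
  have u: "u \<in> carrier_vec m"
    using mat_kernelD(1)[OF R_carrier ker] by simp
  have P: "?P \<in> carrier_mat (n + p) n"
    using system_carriers by simp
  let ?x = "N\<^sub>D\<^sup>T *\<^sub>v u"
  have x: "?x \<in> carrier_vec ND"
    using D.NT u by (rule mult_mat_vec_carrier)
  let ?b = "(- M\<^sub>B *\<^sub>v ?x) @\<^sub>v (M\<^sub>D *\<^sub>v ?x)"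
  have st: "state (rat_vec u) \<in> carrier_vec n"
    using u by (intro state_carrier) simp
  have rx: "rat_vec ?x = rat_mat N\<^sub>D\<^sup>T *\<^sub>v rat_vec u"
    by (rule to_fract_hom.mult_mat_vec_hom[OF D.NT u])
  have eqs: "rat_mat sysA *\<^sub>v state (rat_vec u) + rat_mat sysB *\<^sub>v rat_vec u = 0\<^sub>v n"
      "rat_mat sysD *\<^sub>v rat_vec u = rat_mat sysC *\<^sub>v state (rat_vec u)"
    using system_kernel_iff[OF st, of "rat_vec u"] ker u
      mat_kernel_system_matrix[OF system_carriers st, of "rat_vec u"] by auto
  have B: "rat_mat sysB *\<^sub>v rat_vec u = rat_vec (M\<^sub>B *\<^sub>v ?x)"
    unfolding to_fract_hom.mult_mat_vec_hom[OF M\<^sub>B(1) x] rx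
    using rat_mat_mult_assoc[OF M\<^sub>B(1) D.NT] u by simp
  have D: "rat_mat sysD *\<^sub>v rat_vec u = rat_vec (M\<^sub>D *\<^sub>v ?x)"
    unfolding to_fract_hom.mult_mat_vec_hom[OF D.M x] rx
    using rat_mat_mult_assoc[OF D.M D.NT] u by simp
  have MBx: "M\<^sub>B *\<^sub>v ?x \<in> carrier_vec n" and MDx: "M\<^sub>D *\<^sub>v ?x \<in> carrier_vec p"
    using mult_mat_vec_carrier[OF M\<^sub>B(1) x] mult_mat_vec_carrier[OF D.M x] .
  have "rat_mat sysA *\<^sub>v state (rat_vec u) = rat_vec (- M\<^sub>B *\<^sub>v ?x)"
  proof -
    have "rat_mat sysA *\<^sub>v state (rat_vec u) \<in> carrier_vec n"
      by (rule mult_mat_vec_carrier[OF rat_system_carriers(1) st])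
    moreover have "- M\<^sub>B *\<^sub>v ?x = - (M\<^sub>B *\<^sub>v ?x)"
      by (rule uminus_mult_mat_vec[OF M\<^sub>B(1) x])
    ultimately show ?thesis
      using eqs(1) MBx add_eq_zero_vec_iff[of _ n "rat_vec (M\<^sub>B *\<^sub>v ?x)"] unfolding B
      by (auto intro!: eq_vecI)
  qed
  moreover have "rat_mat sysC *\<^sub>v state (rat_vec u) = rat_vec (M\<^sub>D *\<^sub>v ?x)"
    using eqs(2) D by simp
  moreover have "rat_vec ?b = rat_vec (- M\<^sub>B *\<^sub>v ?x) @\<^sub>v rat_vec (M\<^sub>D *\<^sub>v ?x)"
    by (rule rat_vec_append)
  ultimately have img: "rat_mat ?P *\<^sub>v state (rat_vec u) = rat_vec ?b"
    using rat_mat_append_rows[OF system_carriers(1,3)] st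
      mat_mult_append[of "rat_mat sysA" n n "rat_mat sysC" p] system_carriers by simp
  obtain v where v: "v \<in> carrier_vec n" "state (rat_vec u) = rat_vec v"
    using polynomial_of_polynomial_image[OF P values_injective st img] by blast
  have Pv: "?P *\<^sub>v v = ?b"
    using img to_fract_hom.mult_mat_vec_hom[OF P v(1)] unfolding v(2)
    by (metis to_fract_hom.vec_hom_inj)
  have degP: "mat_degree ?P \<le> \<rho>\<^sub>A + 1"
  proof -
    show ?thesis
      using mat_degree_append_rows[OF system_carriers(1,3)] A.degree_mult_NT[OF A.M A.linear_M]
        A.degree_mult_NT[OF M\<^sub>C(1)] M\<^sub>C(2)
      unfolding linear_mat_iff_mat_degree by blast
  qed
  have "\<rho>\<^sub>A + vec_degree v \<le> vec_degree ?x" if "v \<noteq> 0\<^sub>v n"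
  proof -
    have "\<rho>\<^sub>A + 1 + vec_degree v = vec_degree ?b"
      using vec_degree_mult_eq[OF P degP leading_injective v(1) that] Pv by simp
    also have "\<dots> \<le> 1 + vec_degree ?x"
    proof -
      have "mat_degree (- M\<^sub>B) \<le> 1"
        using M\<^sub>B(2) unfolding linear_mat_iff_mat_degree mat_degree_le_iff by simp
      then show ?thesis
        using vec_degree_mult_le[of "- M\<^sub>B" n ND ?x 1 "vec_degree ?x"] M\<^sub>B(1) x
          vec_degree_mult_le[OF D.M x D.linear_M order_refl]
        by (simp add: vec_degree_append)
    qed
    finally show ?thesis by simp
  qed
  with v that show thesis by blast
qed

text \<open>
  The first component \<open>N\<^sub>A\<^sup>T v\<close> has degree \<open>\<rho>\<^sub>A + deg v\<close>, unless \<open>v = 0\<close>, and so the bound on \<open>deg v\<close>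
  makes it dominated by the second one.
\<close>
lemma polynomial_embedding:
  assumes ker: "rat_vec u \<in> mat_kernel R"
  obtains y where "embed *\<^sub>v rat_vec u = rat_vec (y @\<^sub>v (N\<^sub>D\<^sup>T *\<^sub>v u))"
    "vec_degree y \<le> vec_degree (N\<^sub>D\<^sup>T *\<^sub>v u)"
proof -
  have u: "u \<in> carrier_vec m"
    using mat_kernelD(1)[OF R_carrier ker] by simp
  obtain v where v: "v \<in> carrier_vec n" "state (rat_vec u) = rat_vec v"
      "\<rho>\<^sub>A + vec_degree v \<le> vec_degree (N\<^sub>D\<^sup>T *\<^sub>v u) \<or> v = 0\<^sub>v n"
    using polynomial_state[OF ker] .
  have "embed *\<^sub>v rat_vec u = rat_vec ((N\<^sub>A\<^sup>T *\<^sub>v v) @\<^sub>v (N\<^sub>D\<^sup>T *\<^sub>v u))"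
    unfolding rat_vec_append to_fract_hom.mult_mat_vec_hom[OF A.NT v(1)]
      to_fract_hom.mult_mat_vec_hom[OF D.NT u] v(2)[symmetric]
    using u by (intro embed_mult) simp
  moreover have "vec_degree (N\<^sub>A\<^sup>T *\<^sub>v v) \<le> vec_degree (N\<^sub>D\<^sup>T *\<^sub>v u)"
  proof (cases "v = 0\<^sub>v n")
    case True
    then have "degree ((N\<^sub>A\<^sup>T *\<^sub>v v) $ i) \<le> 0" if "i < NA" for i
      using that A.NT by simp
    then show ?thesis
      using A.NT by (auto simp: vec_degree_le_iff)
  next
    case False
    then show ?thesis
      using v(3) A.degree_NT_mult[OF v(1)] by simp
  qed
  ultimately show thesis using that by blast
qed

sublocale pencil: degree_shift R "rat_mat L" embed p "NA + (p + \<rho>\<^sub>D * m)" m "NA + ND" \<rho>\<^sub>D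
proof (unfold_locales)
  fix w assume w: "w \<in> mat_kernel R"
  then have wc: "w \<in> carrier_vec m"
    by (rule mat_kernelD(1)[OF R_carrier])
  show "embed *\<^sub>v w \<in> mat_kernel (rat_mat L)"
    unfolding embed_mult[OF wc] mat_kernel_L_lift[OF state_carrier[OF wc] wc]
      system_kernel_iff[OF state_carrier[OF wc] wc]
    using w by simp
  have TD: "rat_mat N\<^sub>D\<^sup>T \<in> carrier_mat ND m" "rat_mat N\<^sub>A\<^sup>T \<in> carrier_mat NA n"
    using D.NT A.NT by auto
  have first: "rat_mat N\<^sub>A\<^sup>T *\<^sub>v state w \<in> carrier_vec NA"
    using mult_mat_vec_carrier[OF TD(2) state_carrier[OF wc]] .
  show "w = 0\<^sub>v m" if "embed *\<^sub>v w = 0\<^sub>v (NA + ND)"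
  proof -
    have "0\<^sub>v (NA + ND) = 0\<^sub>v NA @\<^sub>v (0\<^sub>v ND :: 'a poly fract vec)"
      by (intro eq_vecI) auto
    then have "rat_mat N\<^sub>D\<^sup>T *\<^sub>v w = 0\<^sub>v ND"
      using that append_vec_eq[OF first zero_carrier_vec] unfolding embed_mult[OF wc] by metis
    then show ?thesis
      by (rule injective_matD[OF D.injective_NT TD(1) wc])
  qed
  show "\<exists>u. w = rat_vec u" if "embed *\<^sub>v w = rat_vec z" for z
  proof -
    have "z \<in> carrier_vec (NA + ND)"
      using arg_cong[OF that, of dim_vec] embed_carrier by (intro carrier_vecI) simp
    then obtain y x where yx: "y \<in> carrier_vec NA" "z = y @\<^sub>v x"
      by (metis vec_first_last_append vec_first_carrier)
    have "rat_vec y \<in> carrier_vec NA"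
      using yx(1) by simp
    from append_vec_eq[OF first this] have "rat_mat N\<^sub>D\<^sup>T *\<^sub>v w = rat_vec x"
      using that unfolding embed_mult[OF wc] yx(2) rat_vec_append by blast
    then show ?thesis
      using D.polynomial_NT_preimage[OF wc] by blast
  qed
next
  fix z assume z: "z \<in> mat_kernel (rat_mat L)"
  then obtain v u where vu: "v \<in> carrier_vec n" "u \<in> carrier_vec m"
      "z = (rat_mat N\<^sub>A\<^sup>T *\<^sub>v v) @\<^sub>v (rat_mat N\<^sub>D\<^sup>T *\<^sub>v u)"
    by (rule mat_kernel_L_cases)
  have "u \<in> mat_kernel R" "v = state u"
    using z system_kernel_iff[OF vu(1,2)] mat_kernel_L_lift[OF vu(1,2)] unfolding vu(3) by auto
  then show "\<exists>w\<in>mat_kernel R. z = embed *\<^sub>v w"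
    using embed_mult[OF vu(2)] vu(3) by (intro bexI[of _ u]) simp_all
next
  fix u z assume u: "rat_vec u \<in> mat_kernel R"
  then obtain y where y: "embed *\<^sub>v rat_vec u = rat_vec (y @\<^sub>v (N\<^sub>D\<^sup>T *\<^sub>v u))"
      "vec_degree y \<le> vec_degree (N\<^sub>D\<^sup>T *\<^sub>v u)"
    by (rule polynomial_embedding)
  then show "\<exists>z. embed *\<^sub>v rat_vec u = rat_vec z" by blast
  have uc: "u \<in> carrier_vec m"
    using mat_kernelD(1)[OF R_carrier u] by simp
  assume "u \<noteq> 0\<^sub>v m" "embed *\<^sub>v rat_vec u = rat_vec z"
  then have "z = y @\<^sub>v (N\<^sub>D\<^sup>T *\<^sub>v u)"
    using y(1) by (metis to_fract_hom.vec_hom_inj)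
  then show "vec_degree z = vec_degree u + \<rho>\<^sub>D"
    using y(2) D.degree_NT_mult[OF uc \<open>u \<noteq> 0\<^sub>v m\<close>] by (simp add: vec_degree_append)
qed (fact R_carrier L_carrier embed_carrier)+

lemma R'_kernel_iff:
  assumes "y \<in> carrier_vec NA" "x \<in> carrier_vec ND"
  shows "y @\<^sub>v x \<in> mat_kernel (rat_mat L) \<longleftrightarrow> x \<in> mat_kernel R' \<and>
    y = - (the (mat_inverse (rat_mat linA)) *\<^sub>v (rat_mat linB *\<^sub>v x))"
  by (rule system_kernel_iff_transfer_kernel[OF pencil_carriers injective_linA assms])

sublocale transfer: degree_shift R R' "rat_mat N\<^sub>D\<^sup>T" p "p + \<rho>\<^sub>D * m" m ND \<rho>\<^sub>D
proof (unfold_locales)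
  show TD: "rat_mat N\<^sub>D\<^sup>T \<in> carrier_mat ND m"
    using D.NT by simp
  have TA: "rat_mat N\<^sub>A\<^sup>T \<in> carrier_mat NA n"
    using A.NT by simp
  {
    fix w assume w: "w \<in> mat_kernel R"
    then have wc: "w \<in> carrier_vec m"
      by (rule mat_kernelD(1)[OF R_carrier])
    show "rat_mat N\<^sub>D\<^sup>T *\<^sub>v w \<in> mat_kernel R'"
      using pencil.maps[OF w] unfolding embed_mult[OF wc]
      using R'_kernel_iff[OF mult_mat_vec_carrier[OF TA state_carrier[OF wc]]
          mult_mat_vec_carrier[OF TD wc]] by simp
    show "w = 0\<^sub>v m" if "rat_mat N\<^sub>D\<^sup>T *\<^sub>v w = 0\<^sub>v ND"
      using injective_matD[OF D.injective_NT TD wc that] .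
    show "\<exists>u. w = rat_vec u" if "rat_mat N\<^sub>D\<^sup>T *\<^sub>v w = rat_vec z" for z
      using D.polynomial_NT_preimage[OF wc that] by blast
  next
    fix x assume x: "x \<in> mat_kernel R'"
    then have xc: "x \<in> carrier_vec ND"
      by (rule mat_kernelD(1)[OF R'_carrier])
    \<comment> \<open>The state of the pencil that completes \<open>x\<close> to a kernel vector of \<open>L\<close>.\<close>
    define y where "y = - (the (mat_inverse (rat_mat linA)) *\<^sub>v (rat_mat linB *\<^sub>v x))"
    have "the (mat_inverse (rat_mat linA)) \<in> carrier_mat NA NA"
      by (rule mat_inverse_injective(1)[OF rat_pencil_carriers(1) injective_linA])
    from mult_mat_vec_carrier[OF this mult_mat_vec_carrier[OF rat_pencil_carriers(2) xc]]
    have "y \<in> carrier_vec NA"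
      unfolding y_def by (rule uminus_carrier_vec[THEN iffD2])
    then have ker: "y @\<^sub>v x \<in> mat_kernel (rat_mat L)"
      using R'_kernel_iff[OF _ xc] x y_def by blast
    then obtain w where w: "w \<in> mat_kernel R" "y @\<^sub>v x = embed *\<^sub>v w"
      using pencil.onto by blast
    then have wc: "w \<in> carrier_vec m"
      using mat_kernelD(1)[OF R_carrier] by blast
    have "x = rat_mat N\<^sub>D\<^sup>T *\<^sub>v w"
      using w(2) append_vec_eq[OF \<open>y \<in> carrier_vec NA\<close> mult_mat_vec_carrier[OF TA state_carrier[OF wc]]]
      unfolding embed_mult[OF wc] by blast
    then show "\<exists>w\<in>mat_kernel R. x = rat_mat N\<^sub>D\<^sup>T *\<^sub>v w"
      using w(1) by blast
  next
    fix u z assume u: "rat_vec u \<in> mat_kernel R"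
    then have uc: "u \<in> carrier_vec m"
      using mat_kernelD(1)[OF R_carrier u] by simp
    have img: "rat_mat N\<^sub>D\<^sup>T *\<^sub>v rat_vec u = rat_vec (N\<^sub>D\<^sup>T *\<^sub>v u)"
      using to_fract_hom.mult_mat_vec_hom[OF D.NT uc] by simp
    then show "\<exists>z. rat_mat N\<^sub>D\<^sup>T *\<^sub>v rat_vec u = rat_vec z" by blast
    assume "u \<noteq> 0\<^sub>v m" "rat_mat N\<^sub>D\<^sup>T *\<^sub>v rat_vec u = rat_vec z"
    then show "vec_degree z = vec_degree u + \<rho>\<^sub>D"
      using D.degree_NT_mult[OF uc] img by (metis add.commute to_fract_hom.vec_hom_inj)
  }
qed (fact R_carrier R'_carrier)+

end

section \<open>Minimal bases and minimal indices of the pencil\<close>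

lemma sort_map_add: "sort (map (\<lambda>x. x + d) ks) = map (\<lambda>x. x + d) (sort ks)" for d :: nat
  by (rule properties_for_sort) (auto simp: sorted_map intro: sorted_wrt_mono_rel[of _ "(\<le>)"])

context linearized_system
begin

text \<open>
  The second component of \<open>embed\<close> is \<open>N\<^sub>D\<^sup>T\<close>, so the vectors that correspond to a family in the kernel
  of the pencil also correspond to its second components in the kernel of \<open>R'\<close>.
\<close>
lemma related_split:
  assumes rel: "pencil.related us (map2 (@\<^sub>v) ys xs)" and len: "length ys = length xs"
    and ys: "set ys \<subseteq> carrier_vec NA" and xs: "set xs \<subseteq> carrier_vec ND"
  shows "transfer.related us xs" "xs = map (\<lambda>u. N\<^sub>D\<^sup>T *\<^sub>v u) us"
proof -
  have lenu: "length us = length xs"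
    using pencil.related_length[OF rel] len by simp
  have u: "rat_vec (us ! i) \<in> mat_kernel R" "us ! i \<in> carrier_vec m"
      "rat_mat N\<^sub>D\<^sup>T *\<^sub>v rat_vec (us ! i) = rat_vec (xs ! i)" if i: "i < length us" for i
  proof -
    show ker: "rat_vec (us ! i) \<in> mat_kernel R"
      using rel i by (simp add: pencil.related_def list_all2_conv_all_nth)
    have img: "embed *\<^sub>v rat_vec (us ! i) = rat_vec (ys ! i @\<^sub>v xs ! i)"
      using rel i lenu len by (simp add: pencil.related_def list_all2_conv_all_nth)
    show carr: "us ! i \<in> carrier_vec m"
      using mat_kernelD(1)[OF R_carrier ker] by simp
    then have carr': "rat_vec (us ! i) \<in> carrier_vec m"
      by simp
    have yi: "rat_vec (ys ! i) \<in> carrier_vec NA"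
      using ys i lenu len by (metis map_carrier_vec nth_mem subsetD)
    have TA: "rat_mat N\<^sub>A\<^sup>T \<in> carrier_mat NA n"
      using A.NT by simp
    show "rat_mat N\<^sub>D\<^sup>T *\<^sub>v rat_vec (us ! i) = rat_vec (xs ! i)"
      using img append_vec_eq[OF mult_mat_vec_carrier[OF TA state_carrier[OF carr']] yi]
      unfolding embed_mult[OF carr'] rat_vec_append by blast
  qed
  show "transfer.related us xs"
    using u lenu by (simp add: transfer.related_def list_all2_conv_all_nth)
  show "xs = map (\<lambda>u. N\<^sub>D\<^sup>T *\<^sub>v u) us"
  proof (rule nth_equalityI)
    fix i assume "i < length xs"
    then have i: "i < length us" using lenu by simp
    have "rat_vec (N\<^sub>D\<^sup>T *\<^sub>v us ! i) = rat_vec (xs ! i)"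
      using u(3)[OF i] to_fract_hom.mult_mat_vec_hom[OF D.NT u(2)[OF i]] by simp
    then show "xs ! i = map (\<lambda>u. N\<^sub>D\<^sup>T *\<^sub>v u) us ! i"
      using i to_fract_hom.vec_hom_inj by fastforce
  qed (simp add: lenu)
qed

lemma pencil_minimal_basis_split:
  assumes min: "right_minimal_basis (rat_mat L) (map2 (@\<^sub>v) ys xs)"
    and len: "length ys = length xs"
    and ys: "set ys \<subseteq> carrier_vec NA" and xs: "set xs \<subseteq> carrier_vec ND"
  obtains us where "right_minimal_basis R us" "right_minimal_basis R' xs"
    "xs = map (\<lambda>u. N\<^sub>D\<^sup>T *\<^sub>v u) us"
    "map vec_degree (map2 (@\<^sub>v) ys xs) = map (\<lambda>u. vec_degree u + \<rho>\<^sub>D) us"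
    "map vec_degree xs = map (\<lambda>u. vec_degree u + \<rho>\<^sub>D) us"
proof -
  have dims: "dim_col (rat_mat L) = NA + ND" "dim_col R = m" "dim_col R' = ND"
    using carrier_matD(2)[OF L_carrier] carrier_matD(2)[OF R_carrier] carrier_matD(2)[OF R'_carrier] .
  have minL: "minimal_basis (NA + ND) (mat_kernel (rat_mat L)) (map2 (@\<^sub>v) ys xs)"
    using min unfolding right_minimal_basis_def dims .
  then obtain us where us: "pencil.related us (map2 (@\<^sub>v) ys xs)" "poly_basis m (mat_kernel R) us"
    using pencil.poly_basis_lift unfolding minimal_basis_def by blast
  note rel = related_split[OF us(1) len ys xs]
  have minR: "minimal_basis m (mat_kernel R) us"
    using pencil.related_minimal_basis[OF us(1)] minL by blast
  show thesis
  proof (rule that[of us])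
    show "right_minimal_basis R us"
      unfolding right_minimal_basis_def dims by (rule minR)
    show "right_minimal_basis R' xs"
      unfolding right_minimal_basis_def dims
      using transfer.related_minimal_basis[OF rel(1)] minR by blast
  qed (use rel(2) pencil.related_degrees[OF us] transfer.related_degrees[OF rel(1) us(2)] in blast)+
qed

lemma pencil_minimal_indices_shift:
  assumes es: "right_minimal_indices (rat_mat L) es"
  shows "right_minimal_indices R' es" "\<forall>e\<in>set es. \<rho>\<^sub>D \<le> e"
    "right_minimal_indices R (map (\<lambda>e. e - \<rho>\<^sub>D) es)"
proof -
  obtain zs where zs: "right_minimal_basis (rat_mat L) zs" "es = sort (map vec_degree zs)"
    using es unfolding right_minimal_indices_def minimal_indices_def right_minimal_basis_def by blast
  have "set zs \<subseteq> carrier_vec (NA + ND)"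
    using zs(1) carrier_matD(2)[OF L_carrier]
    unfolding right_minimal_basis_def minimal_basis_def poly_basis_def by simp
  then have split: "vec_first z NA @\<^sub>v vec_last z ND = z" if "z \<in> set zs" for z
    using that by (intro vec_first_last_append) auto
  define ys xs where "ys = map (\<lambda>z. vec_first z NA) zs" and "xs = map (\<lambda>z. vec_last z ND) zs"
  have zs_eq: "map2 (@\<^sub>v) ys xs = zs"
    unfolding ys_def xs_def using split by (intro nth_equalityI) auto
  have "set ys \<subseteq> carrier_vec NA" "set xs \<subseteq> carrier_vec ND" "length ys = length xs"
    by (auto simp: ys_def xs_def)
  then obtain us where us: "right_minimal_basis R us" "right_minimal_basis R' xs"
      "map vec_degree zs = map (\<lambda>u. vec_degree u + \<rho>\<^sub>D) us"
      "map vec_degree xs = map (\<lambda>u. vec_degree u + \<rho>\<^sub>D) us"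
    using pencil_minimal_basis_split[of ys xs] zs(1) unfolding zs_eq by metis
  have es_eq: "es = map (\<lambda>k. k + \<rho>\<^sub>D) (sort (map vec_degree us))"
    unfolding zs(2) us(3) using sort_map_add[of \<rho>\<^sub>D "map vec_degree us"] by (simp add: comp_def)
  show "right_minimal_indices R' es"
    using us(2-4) zs(2)
    unfolding right_minimal_indices_def minimal_indices_def right_minimal_basis_def by metis
  show "\<forall>e\<in>set es. \<rho>\<^sub>D \<le> e"
    unfolding es_eq by auto
  have "map (\<lambda>e. e - \<rho>\<^sub>D) es = sort (map vec_degree us)"
    unfolding es_eq by (simp add: comp_def)
  then show "right_minimal_indices R (map (\<lambda>e. e - \<rho>\<^sub>D) es)"
    using us(1)
    unfolding right_minimal_indices_def minimal_indices_def right_minimal_basis_def by metis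
qed

end

theorem theorem6p8:
  fixes R :: "'a::alg_closed_field poly fract mat"
    and A B C D :: "'a poly mat"
    and M\<^sub>A K\<^sub>A N\<^sub>A M\<^sub>D K\<^sub>D N\<^sub>D M\<^sub>B M\<^sub>C :: "'a poly mat"
    and n m p \<rho>\<^sub>A \<rho>\<^sub>D :: nat
  defines "\<L> \<equiv> system_matrix (M\<^sub>A @\<^sub>r K\<^sub>A) (M\<^sub>B @\<^sub>r 0\<^sub>m (\<rho>\<^sub>A * n) ((\<rho>\<^sub>D + 1) * m))
                  (M\<^sub>C @\<^sub>r 0\<^sub>m (\<rho>\<^sub>D * m) ((\<rho>\<^sub>A + 1) * n)) (M\<^sub>D @\<^sub>r K\<^sub>D)"
    and "R' \<equiv> transfer_function (M\<^sub>A @\<^sub>r K\<^sub>A) (M\<^sub>B @\<^sub>r 0\<^sub>m (\<rho>\<^sub>A * n) ((\<rho>\<^sub>D + 1) * m))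
                  (M\<^sub>C @\<^sub>r 0\<^sub>m (\<rho>\<^sub>D * m) ((\<rho>\<^sub>A + 1) * n)) (M\<^sub>D @\<^sub>r K\<^sub>D)"
  assumes A: "A \<in> carrier_mat n n" "regular_mat A"
    and B: "B \<in> carrier_mat n m"
    and C: "C \<in> carrier_mat p n"
    and D: "D \<in> carrier_mat p m"
    and R: "R \<in> carrier_mat p m" "singular_mat R" "R = transfer_function A B C D"
    and \<rho>\<^sub>A: "\<rho>\<^sub>A = mat_degree N\<^sub>A"
    and M\<^sub>A: "M\<^sub>A \<in> carrier_mat n ((\<rho>\<^sub>A + 1) * n)"
    and K\<^sub>A: "K\<^sub>A \<in> carrier_mat (\<rho>\<^sub>A * n) ((\<rho>\<^sub>A + 1) * n)"
    and L\<^sub>A: "strong_block_minimal_basis_pencil M\<^sub>A K\<^sub>A"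
    and N\<^sub>A: "N\<^sub>A \<in> carrier_mat n ((\<rho>\<^sub>A + 1) * n)" "dual_minimal_bases K\<^sub>A N\<^sub>A"
             "equal_row_degrees N\<^sub>A" "M\<^sub>A * N\<^sub>A\<^sup>T = A"
    and \<rho>\<^sub>D: "\<rho>\<^sub>D = mat_degree N\<^sub>D"
    and M\<^sub>D: "M\<^sub>D \<in> carrier_mat p ((\<rho>\<^sub>D + 1) * m)"
    and K\<^sub>D: "K\<^sub>D \<in> carrier_mat (\<rho>\<^sub>D * m) ((\<rho>\<^sub>D + 1) * m)"
    and L\<^sub>D: "strong_block_minimal_basis_pencil M\<^sub>D K\<^sub>D"
    and N\<^sub>D: "N\<^sub>D \<in> carrier_mat m ((\<rho>\<^sub>D + 1) * m)" "dual_minimal_bases K\<^sub>D N\<^sub>D"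
             "equal_row_degrees N\<^sub>D" "M\<^sub>D * N\<^sub>D\<^sup>T = D"
    and M\<^sub>C: "M\<^sub>C \<in> carrier_mat p ((\<rho>\<^sub>A + 1) * n)" "linear_mat M\<^sub>C" "M\<^sub>C * N\<^sub>A\<^sup>T = C"
    and M\<^sub>B: "M\<^sub>B \<in> carrier_mat n ((\<rho>\<^sub>D + 1) * m)" "linear_mat M\<^sub>B" "M\<^sub>B * N\<^sub>D\<^sup>T = B"
    and rank_finite: "\<And>z. vec_space.rank (n + p) (eval_mat A z @\<^sub>r eval_mat C z) = n"
    and rank_infinity: "vec_space.rank (n + p)
           (eval_rat_mat (rev_mat (int \<rho>\<^sub>A + 1) (rat_mat A)) 0 @\<^sub>r
            eval_rat_mat (rev_mat (int \<rho>\<^sub>A + 1) (rat_mat C)) 0) = n"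
  shows "(\<forall>ys xs. length ys = length xs \<and>
            set ys \<subseteq> carrier_vec ((\<rho>\<^sub>A + 1) * n) \<and> set xs \<subseteq> carrier_vec ((\<rho>\<^sub>D + 1) * m) \<and>
            right_minimal_basis (rat_mat \<L>) (map2 (@\<^sub>v) ys xs) \<longrightarrow>
            right_minimal_basis R' xs \<and>
            (\<exists>us. right_minimal_basis R us \<and> xs = map (\<lambda>u. N\<^sub>D\<^sup>T *\<^sub>v u) us)) \<and>
         (\<forall>es. right_minimal_indices (rat_mat \<L>) es \<longrightarrow>
            right_minimal_indices R' es \<and>
            (\<forall>e\<in>set es. \<rho>\<^sub>D \<le> e) \<and> right_minimal_indices R (map (\<lambda>e. e - \<rho>\<^sub>D) es))"
proof -
  interpret A: minimal_basis_pencil M\<^sub>A K\<^sub>A N\<^sub>A n n \<rho>\<^sub>A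
    by unfold_locales (fact M\<^sub>A K\<^sub>A N\<^sub>A L\<^sub>A \<rho>\<^sub>A)+
  \<comment> \<open>Full column rank of the stacked values means that they are injective, and the reversals at \<open>0\<close>
    are the coefficient matrices at degree \<open>\<rho>\<^sub>A + 1\<close>.\<close>
  have "injective_mat (eval_mat (A @\<^sub>r C) z)" for z
    using A(1) C rank_finite[of z] eval_mat_append_rows[OF A(1) C]
    by (intro vec_space.full_rank_injective[of _ "n + p" n]) simp_all
  moreover have "injective_mat (coeff_mat (\<rho>\<^sub>A + 1) (A @\<^sub>r C))"
  proof -
    have degA: "mat_degree A \<le> \<rho>\<^sub>A + 1"
      using A.degree_mult_NT[OF A.M A.linear_M] unfolding N\<^sub>A(4) .
    have degC: "mat_degree C \<le> \<rho>\<^sub>A + 1"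
      using A.degree_mult_NT[OF M\<^sub>C(1)] M\<^sub>C(2) unfolding M\<^sub>C(3) linear_mat_iff_mat_degree .
    have "int \<rho>\<^sub>A + 1 = int (\<rho>\<^sub>A + 1)" by simp
    then have "vec_space.rank (n + p) (coeff_mat (\<rho>\<^sub>A + 1) A @\<^sub>r coeff_mat (\<rho>\<^sub>A + 1) C) = n"
      using rank_infinity eval_rev_mat_at_zero[OF degA] eval_rev_mat_at_zero[OF degC] by metis
    then show ?thesis
      using A(1) C coeff_mat_append_rows[OF A(1) C]
      by (intro vec_space.full_rank_injective[of _ "n + p" n]) simp_all
  qed
  ultimately interpret S: linearized_system M\<^sub>A K\<^sub>A N\<^sub>A M\<^sub>D K\<^sub>D N\<^sub>D n m p \<rho>\<^sub>A \<rho>\<^sub>D M\<^sub>B M\<^sub>C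
    by unfold_locales
      (use M\<^sub>A K\<^sub>A N\<^sub>A L\<^sub>A \<rho>\<^sub>A M\<^sub>D K\<^sub>D N\<^sub>D L\<^sub>D \<rho>\<^sub>D M\<^sub>B M\<^sub>C A(2) in \<open>auto simp: regular_mat_def\<close>)
  have R_eq: "R = transfer_function (M\<^sub>A * N\<^sub>A\<^sup>T) (M\<^sub>B * N\<^sub>D\<^sup>T) (M\<^sub>C * N\<^sub>A\<^sup>T) (M\<^sub>D * N\<^sub>D\<^sup>T)"
    unfolding R(3) N\<^sub>A(4) N\<^sub>D(4) M\<^sub>B(3) M\<^sub>C(3) ..
  show ?thesis
    unfolding R_eq \<L>_def R'_def
    using S.pencil_minimal_basis_split S.pencil_minimal_indices_shift by metis
qed

end
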